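(* Let $\boldsymbol{H}\in\mathbb{R}^{d\times d}$ be a random symmetric positive-definite matrix with expected spectral distribution $\mu$, let $\boldsymbol{x}_0,\boldsymbol{x}^\star\in\mathbb{R}^d$ be random vectors such that $\boldsymbol{x}_0-\boldsymbol{x}^\star$ is independent of $\boldsymbol{H}$ and $\mathbb{E}\,(\boldsymbol{x}_0-\boldsymbol{x}^\star)(\boldsymbol{x}_0-\boldsymbol{x}^\star)^\top=R^2\boldsymbol{I}$, and let $f(\boldsymbol{x})=\frac12(\boldsymbol{x}-\boldsymbol{x}^\star)^\top\boldsymbol{H}(\boldsymbol{x}-\boldsymbol{x}^\star)$. Let $P_t$ be the residual orthogonal polynomials of degree $t$ with respect to the weight function $\lambda\,\mathrm{d}\mu(\lambda)$, and let $a_t,b_t$ be the constants associated with their three-term recurrence. Then the algorithm $$\boldsymbol{x}_t=\boldsymbol{x}_{t-1}+(1-a_t)(\boldsymbol{x}_{t-2}-\boldsymbol{x}_{t-1})+b_t\nabla f(\boldsymbol{x}_{t-1})$$ has the smallest expected error $\mathbb{E}\|\boldsymbol{x}_t-\boldsymbol{x}^\star\|^2$ over the class of oblivious first-order methods. Moreover, its expected error is $$\mathbb{E}\|\boldsymbol{x}_t-\boldsymbol{x}^\star\|^2=R^2\int_{\mathbb{R}}P_t\,\mathrm{d}\mu .$$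
   Context: $\|\cdot\|$ is the Euclidean norm; $\mathbb{E}$ is the expectation over the random $\boldsymbol{H},\boldsymbol{x}_0,\boldsymbol{x}^\star$. First-order method: the iterates, started at $\boldsymbol{x}_0$, satisfy $\boldsymbol{x}_{t+1}\in\boldsymbol{x}_0+\mathrm{span}\{\nabla f(\boldsymbol{x}_0),\dots,\nabla f(\boldsymbol{x}_t)\}$. Oblivious: the coefficients of the update are known in advance and do not depend on previous updates. Spectral distributions: if $\boldsymbol{H}$ has eigenvalues $\lambda_1,\dots,\lambda_d$, its empirical spectral distribution is the random probability measure $\mu_{\boldsymbol{H}}=\frac1d\sum_{i=1}^d\delta_{\lambda_i}$; the expected spectral distribution is $\mu=\mathbb{E}_{\boldsymbol{H}}[\mu_{\boldsymbol{H}}]$, i.e. $\int\varphi\,\mathrm{d}\mu=\mathbb{E}\int\varphi\,\mathrm{d}\mu_{\boldsymbol{H}}$ for every continuous compactly supported $\varphi$ on $\mathbb{R}$. Residual orthogonal polynomials: for a non-decreasing function $\alpha$ such that $\int Q\,\mathrm{d}\alpha$ is finite for all polynomials $Q$, a sequence $P_0,P_1,\dots$ is orthogonal with respect to $\mathrm{d}\alpha$ if $P_i$ has degree $i$, $\int_{\mathbb{R}} P_iP_j\,\mathrm{d}\alpha=0$ for $i\ne j$ and $\int_{\mathbb{R}} P_i^2\,\mathrm{d}\alpha>0$. It is residual orthogonal if moreover $P_i(0)=1$ for all $i$. Three-term recurrence: any sequence of residual orthogonal polynomials satisfies $P_t(\lambda)=(a_t+b_t\lambda)P_{t-1}(\lambda)+(1-a_t)P_{t-2}(\lambda)$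 for some scalars $a_t,b_t$, with $a_0=a_1=1$ and $b_0=0$. Since $a_1=1$, the terms with index $-1$ do not contribute at $t=1$.
   Formalization: The error formula is proved as d·R²∫P_t dμ: the printed R²∫P_t dμ misses the dimension factor d and fails for d ≥ 2, R ≠ 0 (at t = 0 the error is tr(R²I) = dR², but ∫P_0 dμ = 1). *)

theory Defs
  imports "HOL-Probability.Probability" "HOL-Computational_Algebra.Computational_Algebra"
begin

section \<open>Spectral distributions\<close>

definition positive_definite :: "real ^ 'n ^ 'n \<Rightarrow> bool" where
  "positive_definite A \<longleftrightarrow> (\<forall>v. v \<noteq> 0 \<longrightarrow> v \<bullet> (A *v v) > 0)"

definition charpoly :: "real ^ 'n ^ 'n \<Rightarrow> real poly" where
  "charpoly A = det (mat [:0, 1:] - map_matrix (\<lambda>c. [:c:]) A)"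

definition eigenvalues :: "real ^ 'n ^ 'n \<Rightarrow> real multiset" where
  "eigenvalues A = proots (charpoly A)"

text \<open>
  The distribution \<open>pmf_of_multiset S\<close> gives \<open>x\<close> the mass \<open>count S x / size S\<close>. A symmetric
  real matrix of dimension \<open>d\<close> has exactly \<open>d\<close> real eigenvalues counted with multiplicity, so
  for such matrices this is the average of the Dirac measures at the eigenvalues. (If there are no
  real eigenvalues at all, which cannot happen in the symmetric case, the value is meaningless.)
\<close>

definition empirical_spectral_distribution :: "real ^ 'n ^ 'n \<Rightarrow> real measure" where
  "empirical_spectral_distribution A =
     distr (measure_pmf (pmf_of_multiset (eigenvalues A))) borel (\<lambda>x. x)"

definition expected_spectral_distribution ::
    "'a measure \<Rightarrow> ('a \<Rightarrow> real ^ 'n ^ 'n) \<Rightarrow> real measure \<Rightarrow> bool" where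
  "expected_spectral_distribution M H \<mu> \<longleftrightarrow>
     real_distribution \<mu> \<and>
     (\<forall>\<phi> :: real \<Rightarrow> real.
        continuous_on UNIV \<phi> \<and> (\<exists>K. compact K \<and> (\<forall>x. x \<notin> K \<longrightarrow> \<phi> x = 0)) \<longrightarrow>
        (\<integral>x. \<phi> x \<partial>\<mu>) = (\<integral>\<omega>. (\<integral>x. \<phi> x \<partial>empirical_spectral_distribution (H \<omega>)) \<partial>M))"


section \<open>Residual orthogonal polynomials\<close>

definition orthogonal_polynomials :: "real measure \<Rightarrow> (nat \<Rightarrow> real poly) \<Rightarrow> bool" where
  "orthogonal_polynomials \<nu> P \<longleftrightarrow>
     (\<forall>Q. integrable \<nu> (poly Q)) \<and>
     (\<forall>i. degree (P i) = i) \<and>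
     (\<forall>i j. i \<noteq> j \<longrightarrow> (\<integral>x. poly (P i) x * poly (P j) x \<partial>\<nu>) = 0) \<and>
     (\<forall>i. (\<integral>x. (poly (P i) x)\<^sup>2 \<partial>\<nu>) > 0)"

definition residual_orthogonal_polynomials :: "real measure \<Rightarrow> (nat \<Rightarrow> real poly) \<Rightarrow> bool" where
  "residual_orthogonal_polynomials \<nu> P \<longleftrightarrow>
     orthogonal_polynomials \<nu> P \<and> (\<forall>i. poly (P i) 0 = 1)"

text \<open>
  The measure \<open>\<lambda> d\<mu>(\<lambda>)\<close>. Since \<open>ennreal\<close> is \<open>0\<close> on negative arguments, this is only
  the intended object for \<open>\<mu>\<close> carried by the nonnegative reals, as is the case for the expected
  spectral distribution of positive definite matrices.
\<close>

definition weight_measure :: "real measure \<Rightarrow> real measure" where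
  "weight_measure \<mu> = density \<mu> (\<lambda>x. ennreal x)"

definition three_term_coefficients ::
    "(nat \<Rightarrow> real poly) \<Rightarrow> (nat \<Rightarrow> real) \<Rightarrow> (nat \<Rightarrow> real) \<Rightarrow> bool" where
  "three_term_coefficients P a b \<longleftrightarrow>
     a 0 = 1 \<and> a 1 = 1 \<and> b 0 = 0 \<and>
     P 1 = [:a 1, b 1:] * P 0 \<and>
     (\<forall>t\<ge>2. P t = [:a t, b t:] * P (t - 1) + smult (1 - a t) (P (t - 2)))"


section \<open>First-order methods\<close>

definition quadratic_objective :: "real ^ 'n ^ 'n \<Rightarrow> real ^ 'n \<Rightarrow> real ^ 'n \<Rightarrow> real" where
  "quadratic_objective A z x = 1 / 2 * ((x - z) \<bullet> (A *v (x - z)))"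

definition grad :: "('v::real_inner \<Rightarrow> real) \<Rightarrow> 'v \<Rightarrow> 'v" where
  "grad f x = (THE D. GDERIV f x :> D)"

definition first_order_iterates :: "('v::real_inner \<Rightarrow> real) \<Rightarrow> (nat \<Rightarrow> 'v) \<Rightarrow> bool" where
  "first_order_iterates f y \<longleftrightarrow>
     (\<forall>t. y (Suc t) \<in> (+) (y 0) ` span ((\<lambda>s. grad f (y s)) ` {..t}))"

text \<open>
  The objective and the starting point depend on the outcome \<open>\<omega>\<close>. Obliviousness is the fact that
  the coefficients \<open>c\<close> are chosen before \<open>\<omega>\<close>.
\<close>

definition oblivious_first_order_method ::
    "'a measure \<Rightarrow> ('a \<Rightarrow> 'v::real_inner \<Rightarrow> real) \<Rightarrow> ('a \<Rightarrow> 'v) \<Rightarrow> (nat \<Rightarrow> 'a \<Rightarrow> 'v) \<Rightarrow> bool" where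
  "oblivious_first_order_method M f x0 y \<longleftrightarrow>
     (\<forall>\<omega>\<in>space M. y 0 \<omega> = x0 \<omega> \<and> first_order_iterates (f \<omega>) (\<lambda>t. y t \<omega>)) \<and>
     (\<exists>c :: nat \<Rightarrow> nat \<Rightarrow> real. \<forall>\<omega>\<in>space M. \<forall>t.
        y (Suc t) \<omega> = x0 \<omega> + (\<Sum>s\<le>t. c t s *\<^sub>R grad (f \<omega>) (y s \<omega>)))"

text \<open>
  As \<open>a 1 = 1\<close> in a three-term recurrence, the momentum term is absent from the first step.
\<close>

fun momentum_iterates ::
    "(nat \<Rightarrow> real) \<Rightarrow> (nat \<Rightarrow> real) \<Rightarrow> ('v::real_inner \<Rightarrow> real) \<Rightarrow> 'v \<Rightarrow> nat \<Rightarrow> 'v" where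
  "momentum_iterates a b f x0 0 = x0"
| "momentum_iterates a b f x0 (Suc 0) = x0 + b 1 *\<^sub>R grad f x0"
| "momentum_iterates a b f x0 (Suc (Suc t)) =
     (let x1 = momentum_iterates a b f x0 (Suc t); x2 = momentum_iterates a b f x0 t
      in x1 + (1 - a (Suc (Suc t))) *\<^sub>R (x2 - x1) + b (Suc (Suc t)) *\<^sub>R grad f x1)"


section \<open>Random vectors\<close>

text \<open>
  Independence through the generated sigma-algebras: the constant \<open>indep_var\<close> of the library
  forces both variables to have the same codomain.
\<close>

definition independent_variables ::
    "'a measure \<Rightarrow> ('a \<Rightarrow> 'b::topological_space) \<Rightarrow> ('a \<Rightarrow> 'c::topological_space) \<Rightarrow> bool" where
  "independent_variables M X Y \<longleftrightarrow>
     prob_space.indep_set M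
       {X -` A \<inter> space M | A. A \<in> sets borel} {Y -` B \<inter> space M | B. B \<in> sets borel}"

definition outer_product :: "real ^ 'n \<Rightarrow> real ^ 'n \<Rightarrow> real ^ 'n ^ 'n" where
  "outer_product u v = (\<chi> i j. u $ i * v $ j)"

text \<open>
  With second moment matrix \<open>R\<^sup>2 I\<close>, the squared norm has expectation \<open>d R\<^sup>2\<close>, the trace
  of that matrix. Traces of functions of a matrix are \<open>d\<close> times the integral against its
  (normalized) empirical spectral distribution, which is the origin of the dimension factor in error
  formulas based on that normalization.
\<close>

lemma expectation_norm_square_isotropic:
  fixes v :: "'a \<Rightarrow> real ^ 'n"
  assumes "has_bochner_integral M (\<lambda>\<omega>. outer_product (v \<omega>) (v \<omega>)) (R\<^sup>2 *\<^sub>R mat 1)"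
  shows "(\<integral>\<omega>. (norm (v \<omega>))\<^sup>2 \<partial>M) = real CARD('n) * R\<^sup>2"
proof -
  have *: "has_bochner_integral M (\<lambda>\<omega>. (v \<omega> $ i)\<^sup>2) (R\<^sup>2)" for i
  proof -
    have bl: "bounded_linear (\<lambda>A :: real ^ 'n ^ 'n. A $ i $ i)"
      by (intro bounded_linear_compose[OF bounded_linear_vec_nth bounded_linear_vec_nth])
    show ?thesis
      using has_bochner_integral_bounded_linear[OF bl assms]
      by (simp add: outer_product_def mat_def power2_eq_square)
  qed
  have "has_bochner_integral M (\<lambda>\<omega>. \<Sum>i\<in>UNIV. (v \<omega> $ i)\<^sup>2) (\<Sum>i\<in>(UNIV :: 'n set). R\<^sup>2)"
    by (intro has_bochner_integral_sum *)
  moreover have "(norm w)\<^sup>2 = (\<Sum>i\<in>UNIV. (w $ i)\<^sup>2)" for w :: "real ^ 'n"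
    unfolding norm_vec_def L2_set_def by (simp add: sum_nonneg)
  ultimately show ?thesis
    by (simp add: has_bochner_integral_integral_eq)
qed

end

theory Submission
  imports Defs
begin

text \<open>
  The gradient of the objective is \<open>H (x - x\<^sup>\<star>)\<close>, so with fixed coefficients the error at step \<open>t\<close> is
  \<open>p(H) (x\<^sub>0 - x\<^sup>\<star>)\<close> for a polynomial \<open>p\<close> of degree at most \<open>t\<close> with \<open>p(0) = 1\<close>; the momentum
  method realizes \<open>p = P\<^sub>t\<close>. Independence and isotropy turn the expected squared error into \<open>R\<^sup>2\<close> times
  the expectation of the trace of \<open>p(H)\<^sup>2\<close>, that is \<open>d R\<^sup>2 \<integral>p\<^sup>2 d\<mu>\<close>. Finally \<open>p - P\<^sub>t = \<lambda> s\<close> with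
  \<open>deg s < t\<close>, and orthogonality with respect to \<open>\<lambda> d\<mu>\<close> gives \<open>\<integral>P\<^sub>t p d\<mu> = \<integral>P\<^sub>t d\<mu>\<close> for all such \<open>p\<close>,
  including \<open>p = P\<^sub>t\<close>. Hence \<open>\<integral>p\<^sup>2 d\<mu> - \<integral>P\<^sub>t\<^sup>2 d\<mu> = \<integral>(p - P\<^sub>t)\<^sup>2 d\<mu> \<ge> 0\<close>.
\<close>

unbundle no fps_syntax

section \<open>The spectral theorem for real symmetric matrices\<close>

text \<open>The Rayleigh quotient attains a maximum on the compact unit sphere of \<open>S\<close>;
  it is stationary there, which makes the maximizer an eigenvector.\<close>

lemma self_adjoint_eigenvector:
  fixes F :: "'v::euclidean_space \<Rightarrow> 'v"
  assumes "linear F" and self_adjoint: "\<And>x y. F x \<bullet> y = x \<bullet> F y"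
    and "subspace S" and inv: "\<And>x. x \<in> S \<Longrightarrow> F x \<in> S" and "S \<noteq> {0}"
  obtains v c where "v \<in> S" "norm v = 1" "F v = c *\<^sub>R v"
proof -
  interpret F: linear F by fact
  define K where "K = sphere 0 1 \<inter> S"
  have "compact K"
    unfolding K_def using closed_subspace[OF \<open>subspace S\<close>] by (simp add: compact_Int_closed)
  moreover have "K \<noteq> {}"
  proof -
    obtain u where "u \<in> S" "u \<noteq> 0"
      using \<open>S \<noteq> {0}\<close> subspace_0[OF \<open>subspace S\<close>] by auto
    then have "u /\<^sub>R norm u \<in> K"
      unfolding K_def using \<open>subspace S\<close> by (auto intro: subspace_scale)
    then show ?thesis by auto
  qed
  moreover have "continuous_on K (\<lambda>v. v \<bullet> F v)"
    using linear_continuous_on[of F K] \<open>linear F\<close> 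
    by (intro continuous_intros) (simp add: linear_conv_bounded_linear)
  ultimately obtain v where v: "v \<in> K" and max: "\<And>w. w \<in> K \<Longrightarrow> w \<bullet> F w \<le> v \<bullet> F v"
    using continuous_attains_sup by metis
  define m where "m = v \<bullet> F v"
  have vS: "v \<in> S" and nv: "norm v = 1" and vv: "v \<bullet> v = 1"
    using v unfolding K_def by (auto simp: norm_eq_1)
  have rayleigh: "w \<bullet> F w \<le> m * (w \<bullet> w)" if "w \<in> S" for w
  proof (cases "w = 0")
    case False
    have "w /\<^sub>R norm w \<in> K"
      using that False \<open>subspace S\<close> unfolding K_def by (auto intro: subspace_scale)
    from max[OF this] have "(w \<bullet> F w) / (norm w)\<^sup>2 \<le> m"
      by (simp add: F.scale m_def power2_eq_square divide_simps)
    then show ?thesis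
      using False by (simp add: divide_simps dot_square_norm)
  qed simp
  \<comment> \<open>Stationarity of the Rayleigh quotient at the maximizer \<open>v\<close> along the direction \<open>w\<close>.\<close>
  have stationary: "F v \<bullet> w = 0" if "w \<in> S" "v \<bullet> w = 0" for w
  proof (rule ccontr)
    assume "F v \<bullet> w \<noteq> 0"
    define g where "g = F v \<bullet> w"
    define C where "C = m * (w \<bullet> w) - w \<bullet> F w"
    \<comment> \<open>The Rayleigh bound at \<open>v + t *\<^sub>R w\<close>; the constant terms on
      both sides equal \<open>m\<close> and cancel.\<close>
    have quad: "2 * t * g \<le> t\<^sup>2 * C" for t
    proof -
      have "v + t *\<^sub>R w \<in> S"
        using that vS \<open>subspace S\<close> by (auto intro: subspace_add subspace_scale)
      from rayleigh[OF this] show ?thesis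
        using that vv
        by (simp add: F.add F.scale inner_add_left inner_add_right m_def[symmetric] g_def C_def
            self_adjoint[of v w] inner_commute[of w v] inner_commute[of w "F v"]
            power2_eq_square algebra_simps)
    qed
    have "g * g > 0"
      using \<open>F v \<bullet> w \<noteq> 0\<close> by (metis g_def not_real_square_gt_zero)
    have C: "0 \<le> C"
      unfolding C_def using rayleigh[OF \<open>w \<in> S\<close>] by simp
    \<comment> \<open>For this \<open>t\<close> the linear term beats the quadratic one: up to a
      positive factor the inequality reads \<open>2 * (C + 1) \<le> C\<close>. The summand 1 avoids
      a division by zero when \<open>C = 0\<close>.\<close>
    have "2 * (g / (C + 1)) * g \<le> (g / (C + 1))\<^sup>2 * C"
      by (rule quad)
    also have "\<dots> = (g * g) * C / ((C + 1) * (C + 1))"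
      by (simp add: power2_eq_square)
    finally have "(2 * (g * g) * (C + 1)) / ((C + 1) * (C + 1)) \<le> (g * g) * C / ((C + 1) * (C + 1))"
      using C by (simp add: add_nonneg_eq_0_iff)
    then have "2 * (g * g) * (C + 1) \<le> (g * g) * C"
      using C by (subst (asm) divide_le_cancel) (auto simp: not_less)
    then have "(g * g) * (C + 2) \<le> 0"
      by (simp add: algebra_simps)
    with C \<open>g * g > 0\<close> show False
      by (smt (verit) mult_pos_pos)
  qed
  \<comment> \<open>The component of \<open>F v\<close> orthogonal to \<open>v\<close>. Being
    orthogonal to both \<open>v\<close> and \<open>F v\<close>, it is orthogonal to itself.\<close>
  define w where "w = F v - m *\<^sub>R v"
  have "w \<in> S"
    unfolding w_def using vS inv \<open>subspace S\<close> by (auto intro: subspace_diff subspace_scale)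
  moreover have vw: "v \<bullet> w = 0"
    by (simp add: w_def inner_diff_right m_def vv)
  ultimately have "F v \<bullet> w = 0"
    by (rule stationary)
  then have "w \<bullet> w = 0"
    using vw by (subst (1) w_def) (simp add: inner_diff_left)
  then have "F v = m *\<^sub>R v"
    by (simp add: w_def)
  with vS nv show thesis by (rule that)
qed

text \<open>Strong induction on the dimension: split off one eigenvector \<open>v\<close>. Its
  orthogonal complement in \<open>S\<close> is again invariant, since
  \<open>v \<bullet> F w = F v \<bullet> w = c * (v \<bullet> w)\<close>.\<close>

lemma self_adjoint_orthonormal_eigenbasis:
  fixes F :: "'v::euclidean_space \<Rightarrow> 'v"
  assumes "linear F" and self_adjoint: "\<And>x y. F x \<bullet> y = x \<bullet> F y"
    and "subspace S" and inv: "\<And>x. x \<in> S \<Longrightarrow> F x \<in> S"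
  obtains B where "B \<subseteq> S" "pairwise orthogonal B" "\<And>v. v \<in> B \<Longrightarrow> norm v = 1"
    "\<And>v. v \<in> B \<Longrightarrow> \<exists>c. F v = c *\<^sub>R v" "span B = S"
  using assms(3,4)
proof (induction "dim S" arbitrary: S thesis rule: less_induct)
  case less
  show ?case
  proof (cases "S = {0}")
    case True
    show ?thesis
      by (rule less.prems(1)[of "{}"]) (simp_all add: True pairwise_def)
  next
    case False
    obtain v c where v: "v \<in> S" "norm v = 1" "F v = c *\<^sub>R v"
      using self_adjoint_eigenvector[OF \<open>linear F\<close> self_adjoint less.prems(2) less.prems(3) False]
      by metis
    define T where "T = {w \<in> S. v \<bullet> w = 0}"
    have T: "subspace T"
      unfolding T_def using less.prems(2) by (auto simp: subspace_def inner_add_right)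
    have "F w \<in> T" if "w \<in> T" for w
      using that less.prems(3) self_adjoint[of v w] v(3) by (auto simp: T_def)
    moreover have "dim T < dim S"
    proof (rule dim_psubset)
      have "v \<notin> T"
        using v(2) by (auto simp: T_def)
      moreover have "T \<subseteq> S"
        by (auto simp: T_def)
      ultimately have "T \<subset> S"
        using v(1) by blast
      then show "span T \<subset> span S"
        using T less.prems(2) by (simp add: span_eq_iff[THEN iffD2])
    qed
    ultimately obtain B where B: "B \<subseteq> T" "pairwise orthogonal B" "\<And>v. v \<in> B \<Longrightarrow> norm v = 1"
      "\<And>v. v \<in> B \<Longrightarrow> \<exists>c. F v = c *\<^sub>R v" "span B = T"
      using less.hyps[OF _ _ T] by metis
    show ?thesis
    proof (rule less.prems(1))
      show "insert v B \<subseteq> S"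
        using B(1) v(1) by (auto simp: T_def)
      show "pairwise orthogonal (insert v B)"
        using B(1,2) by (auto simp: pairwise_insert T_def orthogonal_def inner_commute)
      show "span (insert v B) = S"
      proof
        show "span (insert v B) \<subseteq> S"
          using B(1) v(1) less.prems(2) by (intro span_minimal) (auto simp: T_def)
        show "S \<subseteq> span (insert v B)"
        proof
          fix w assume w: "w \<in> S"
          have "w - (v \<bullet> w) *\<^sub>R v \<in> T"
            using w v less.prems(2)
            by (auto simp: T_def inner_diff_right dot_square_norm intro: subspace_diff subspace_scale)
          then show "w \<in> span (insert v B)"
            using B(5) by (auto simp: span_insert)
        qed
      qed
    qed (use B v in auto)
  qed
qed

section \<open>Orthogonal diagonalization of matrices\<close>

definition diagonal_matrix :: "('n \<Rightarrow> 'a::zero) \<Rightarrow> 'a ^ 'n ^ 'n" where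
  "diagonal_matrix d = (\<chi> i j. if i = j then d i else 0)"

lemma diagonal_matrix_mult:
  fixes d e :: "'n::finite \<Rightarrow> 'a::semiring_1"
  shows "diagonal_matrix d ** diagonal_matrix e = diagonal_matrix (\<lambda>i. d i * e i)"
proof -
  have "(\<Sum>k\<in>UNIV. (if i = k then d i else 0) * (if k = j then e k else 0)) =
      (\<Sum>k\<in>UNIV. if k = i then d i * (if k = j then e k else 0) else 0)" for i j
    by (rule sum.cong) auto
  then show ?thesis
    by (simp add: diagonal_matrix_def matrix_matrix_mult_def vec_eq_iff)
qed

text \<open>The columns of \<open>Q\<close> form an orthonormal eigenbasis, so \<open>A\<close> acts
  on \<open>Q\<close> by scaling its columns.\<close>

theorem symmetric_matrix_diagonalization:
  fixes A :: "real ^ 'n ^ 'n"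
  assumes "transpose A = A"
  obtains Q d where "orthogonal_matrix Q" "A = Q ** diagonal_matrix d ** transpose Q"
proof -
  have sa: "(A *v x) \<bullet> y = x \<bullet> (A *v y)" for x y
    using assms by (metis dot_lmul_matrix inner_commute transpose_matrix_vector)
  obtain B where B: "pairwise orthogonal B" "\<And>v. v \<in> B \<Longrightarrow> norm v = 1"
      "\<And>v. v \<in> B \<Longrightarrow> \<exists>c. A *v v = c *\<^sub>R v" "span B = (UNIV :: (real ^ 'n) set)"
    using self_adjoint_orthonormal_eigenbasis[OF matrix_vector_mul_linear sa subspace_UNIV] by auto
  have "independent B"
    using B(1,2) by (intro pairwise_orthogonal_independent) force+
  then have "card B = dim (span B)" "finite B"
    by (simp_all add: dim_eq_card_independent independent_imp_finite)
  then have "card B = CARD('n)" "finite B"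
    by (simp_all add: B(4) dim_UNIV)
  \<comment> \<open>The basis has as many vectors as the index type has elements, so it can be
    indexed by \<open>'n\<close> and supply the columns of a square matrix.\<close>
  then obtain q where q: "bij_betw q (UNIV :: 'n set) B"
    using finite_same_card_bij[of "UNIV :: 'n set" B] by auto
  then have qB: "q i \<in> B" for i
    by (auto simp: bij_betw_def)
  obtain d where d: "\<And>i. A *v q i = d i *\<^sub>R q i"
    using B(3)[OF qB] by metis
  define Q where "Q = (\<chi> i j. q j $ i)"
  have "q i \<bullet> q j = (if i = j then 1 else 0)" for i j
  proof (cases "i = j")
    case False
    then have "q i \<noteq> q j"
      using bij_betw_imp_inj_on[OF q] by (auto dest: injD)
    then show ?thesis
      using False B(1) qB[of i] qB[of j] by (auto simp: pairwise_def orthogonal_def)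
  qed (use B(2)[OF qB] in \<open>simp add: dot_square_norm\<close>)
  then have "transpose Q ** Q = mat 1"
    by (simp add: Q_def matrix_matrix_mult_def transpose_def mat_def vec_eq_iff inner_vec_def)
  then have orth: "orthogonal_matrix Q"
    by (simp add: orthogonal_matrix)
  have "A ** Q = Q ** diagonal_matrix d"
  proof -
    have "(A ** Q) $ i $ j = (Q ** diagonal_matrix d) $ i $ j" for i j
    proof -
      have "(A ** Q) $ i $ j = (A *v q j) $ i"
        by (simp add: Q_def matrix_matrix_mult_def matrix_vector_mult_def)
      also have "\<dots> = (Q ** diagonal_matrix d) $ i $ j"
        by (simp add: d Q_def diagonal_matrix_def matrix_matrix_mult_def if_distrib sum.delta
            cong: if_cong)
      finally show ?thesis .
    qed
    then show ?thesis by (simp add: vec_eq_iff)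
  qed
  then have "A = Q ** diagonal_matrix d ** transpose Q"
    using orth by (metis matrix_mul_assoc matrix_mul_rid orthogonal_matrix_def)
  with orth show thesis by (rule that)
qed

section \<open>The spectrum read off from a diagonalization\<close>

lemma map_matrix_mult_const_poly:
  fixes A B :: "'a::comm_ring_1 ^ 'n ^ 'n"
  shows "map_matrix (\<lambda>c. [:c:]) (A ** B) = map_matrix (\<lambda>c. [:c:]) A ** map_matrix (\<lambda>c. [:c:]) B"
proof -
  have add: "[:x + y:] = [:x:] + [:y:]" for x y :: 'a
    by simp
  have "[:\<Sum>k\<in>S. h k:] = (\<Sum>k\<in>S. [:h k:])" for h :: "'n \<Rightarrow> 'a" and S
    by (induction S rule: infinite_finite_induct) (simp_all add: add del: add_pCons)
  then show ?thesis
    by (simp add: vec_eq_iff matrix_matrix_mult_def mult.commute)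
qed

lemma matrix_diff_ldistrib:
  fixes A :: "'a::ring_1 ^ 'n ^ 'm"
  shows "A ** (B - C) = A ** B - A ** C"
  by (simp add: matrix_matrix_mult_def vec_eq_iff right_diff_distrib sum_subtractf)

lemma matrix_diff_rdistrib:
  fixes A :: "'a::ring_1 ^ 'n ^ 'm"
  shows "(A - B) ** C = A ** C - B ** C"
  by (simp add: matrix_matrix_mult_def vec_eq_iff left_diff_distrib sum_subtractf)

text \<open>Over the polynomial ring, conjugation by the constant matrix \<open>C Q\<close> fixes
  the scalar matrix of the variable. Hence the characteristic polynomial is that of the diagonal
  matrix, a product of linear factors.\<close>

lemma eigenvalues_diagonalized:
  fixes A Q :: "real ^ 'n ^ 'n"
  assumes Q: "orthogonal_matrix Q" and A: "A = Q ** diagonal_matrix d ** transpose Q"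
  shows "eigenvalues A = image_mset d (mset_set UNIV)"
proof -
  define C where "C = (map_matrix (\<lambda>c. [:c:]) :: real ^ 'n ^ 'n \<Rightarrow> real poly ^ 'n ^ 'n)"
  have C_mult: "C (X ** Y) = C X ** C Y" for X Y
    by (simp add: C_def map_matrix_mult_const_poly)
  have QQ: "C Q ** C (transpose Q) = mat 1"
    using Q unfolding C_mult[symmetric]
    by (simp add: orthogonal_matrix_def C_def vec_eq_iff mat_def one_pCons)
  have scal: "C Q ** mat [:0, 1:] ** C (transpose Q) = mat [:0, 1:]"
  proof -
    have "C Q ** mat [:0, 1:] = mat [:0, 1:] ** C Q"
      by (simp add: vec_eq_iff matrix_matrix_mult_def mat_def if_distrib if_distribR sum.delta
          sum.delta' mult.commute cong: if_cong)
    then show ?thesis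
      by (metis QQ matrix_mul_assoc matrix_mul_rid)
  qed
  have "mat [:0, 1:] - C A = C Q ** (mat [:0, 1:] - C (diagonal_matrix d)) ** C (transpose Q)"
    by (simp add: scal A C_mult matrix_diff_ldistrib matrix_diff_rdistrib)
  then have "charpoly A = det (C Q) * det (mat [:0, 1:] - C (diagonal_matrix d)) * det (C (transpose Q))"
    by (simp add: charpoly_def C_def[symmetric] det_mul)
  also have "\<dots> = det (C Q ** C (transpose Q)) * det (mat [:0, 1:] - C (diagonal_matrix d))"
    by (simp add: det_mul)
  also have "\<dots> = (\<Prod>i\<in>UNIV. [:- d i, 1:])"
    by (subst (2) det_diagonal)
      (simp_all only: QQ det_I, simp_all add: diagonal_matrix_def C_def mat_def)
  finally have "eigenvalues A = (\<Sum>i\<in>UNIV. proots [:- d i, 1:])"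
    unfolding eigenvalues_def by (simp add: proots_prod)
  also have "\<dots> = image_mset d (mset_set UNIV)"
    by (simp add: sum_unfold_sum_mset)
  finally show ?thesis .
qed

text \<open>The uniform distribution on the indices, pushed forward along \<open>d\<close>, weights
  each eigenvalue by its multiplicity.\<close>

lemma integral_empirical_spectral_distribution:
  fixes A Q :: "real ^ 'n ^ 'n"
  assumes "orthogonal_matrix Q" "A = Q ** diagonal_matrix d ** transpose Q"
    and [measurable]: "\<phi> \<in> borel_measurable borel"
  shows "(\<integral>z. \<phi> z \<partial>empirical_spectral_distribution A) = (\<Sum>i\<in>UNIV. \<phi> (d i)) / real CARD('n)"
proof -
  have "pmf_of_multiset (eigenvalues A) = map_pmf d (pmf_of_set UNIV)"
    by (subst map_pmf_of_set) (simp_all add: eigenvalues_diagonalized[OF assms(1,2)])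
  then have "(\<integral>z. \<phi> z \<partial>empirical_spectral_distribution A) = (\<integral>z. \<phi> z \<partial>measure_pmf (map_pmf d (pmf_of_set UNIV)))"
    by (simp add: empirical_spectral_distribution_def integral_distr)
  then show ?thesis
    by (simp add: integral_pmf_of_set)
qed

section \<open>Polynomials of matrices\<close>

text \<open>Horner's scheme, in the same \<open>fold_coeffs\<close> pattern as \<open>poly\<close>,
  which gives a recursion along \<open>pCons\<close>.\<close>

definition matrix_poly :: "real poly \<Rightarrow> real ^ 'n ^ 'n \<Rightarrow> real ^ 'n ^ 'n" where
  "matrix_poly p A = fold_coeffs (\<lambda>c B. c *\<^sub>R mat 1 + A ** B) p 0"

lemma matrix_mult_0_right [simp]: "(A :: 'a::semiring_1 ^ 'n ^ 'm) ** 0 = 0"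
  by (simp add: matrix_matrix_mult_def vec_eq_iff)

lemma matrix_add_rdistrib:
  fixes A B :: "'a::semiring_1 ^ 'n ^ 'm"
  shows "(A + B) ** C = A ** C + B ** C"
  by (simp add: matrix_matrix_mult_def vec_eq_iff distrib_right sum.distrib)

lemma matrix_poly_0 [simp]: "matrix_poly 0 A = 0"
  by (simp add: matrix_poly_def)

lemma matrix_poly_pCons [simp]: "matrix_poly (pCons c p) A = c *\<^sub>R mat 1 + A ** matrix_poly p A"
  by (cases "p = 0 \<and> c = 0") (auto simp: matrix_poly_def)

lemma matrix_poly_1 [simp]: "matrix_poly 1 A = mat 1"
  by (simp add: one_pCons)

lemma matrix_poly_add: "matrix_poly (p + q) A = matrix_poly p A + matrix_poly q A"
  by (induction p q rule: poly_induct2) (simp_all add: matrix_add_ldistrib scaleR_left_distrib)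

lemma matrix_poly_smult: "matrix_poly (smult c p) A = c *\<^sub>R matrix_poly p A"
proof (induction p)
  case (pCons a p)
  have "A ** (c *\<^sub>R B) = c *\<^sub>R (A ** B)" for B
    by (simp add: matrix_matrix_mult_def vec_eq_iff sum_distrib_left mult_ac)
  then show ?case
    by (simp add: pCons scaleR_right_distrib)
qed simp

lemma matrix_poly_sum: "matrix_poly (\<Sum>i\<in>I. p i) A = (\<Sum>i\<in>I. matrix_poly (p i) A)"
  by (induction I rule: infinite_finite_induct) (simp_all add: matrix_poly_add)

text \<open>In a product of two conjugates the inner factors \<open>transpose Q ** Q\<close> cancel,
  so multiplying by \<open>A\<close> multiplies the diagonal by \<open>d\<close>.\<close>

lemma matrix_poly_diagonalized:
  fixes A Q :: "real ^ 'n ^ 'n"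
  assumes Q: "orthogonal_matrix Q" and A: "A = Q ** diagonal_matrix d ** transpose Q"
  shows "matrix_poly p A = Q ** diagonal_matrix (\<lambda>i. poly p (d i)) ** transpose Q"
proof (induction p)
  case 0
  have "diagonal_matrix (\<lambda>i::'n. 0) = (0 :: real ^ 'n ^ 'n)"
    by (simp add: diagonal_matrix_def vec_eq_iff)
  then show ?case
    by (simp add: matrix_matrix_mult_def vec_eq_iff)
next
  case (pCons c p)
  let ?D = "diagonal_matrix (\<lambda>i. poly p (d i))"
  have scale: "c *\<^sub>R mat 1 = Q ** mat c ** transpose Q"
  proof -
    have "Q ** mat c = c *\<^sub>R Q"
      by (simp add: matrix_matrix_mult_def mat_def vec_eq_iff if_distrib sum.delta' cong: if_cong)
    moreover have "(c *\<^sub>R Q) ** B = c *\<^sub>R (Q ** B)" for B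
      by (simp add: matrix_matrix_mult_def vec_eq_iff sum_distrib_left mult_ac)
    ultimately show ?thesis
      using Q by (metis orthogonal_matrix_def)
  qed
  have "A ** matrix_poly p A = (Q ** diagonal_matrix d ** transpose Q) ** (Q ** ?D ** transpose Q)"
    by (intro arg_cong2[where f = "(**)"] A pCons)
  also have "\<dots> = Q ** diagonal_matrix d ** (transpose Q ** Q) ** ?D ** transpose Q"
    by (simp add: matrix_mul_assoc)
  also have "\<dots> = Q ** diagonal_matrix (\<lambda>i. d i * poly p (d i)) ** transpose Q"
    using Q by (simp add: orthogonal_matrix_def diagonal_matrix_mult flip: matrix_mul_assoc)
  finally have "matrix_poly (pCons c p) A =
      Q ** (mat c + diagonal_matrix (\<lambda>i. d i * poly p (d i))) ** transpose Q"
    by (simp add: scale matrix_add_ldistrib matrix_add_rdistrib)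
  moreover have "mat c + diagonal_matrix (\<lambda>i. d i * poly p (d i)) = diagonal_matrix (\<lambda>i. poly (pCons c p) (d i))"
    by (simp add: mat_def diagonal_matrix_def vec_eq_iff)
  ultimately show ?case by simp
qed

section \<open>Traces and Gram matrices of matrix polynomials\<close>

lemma trace_orthogonal_conjugate:
  fixes Q D :: "real ^ 'n ^ 'n"
  assumes "orthogonal_matrix Q"
  shows "trace (Q ** D ** transpose Q) = trace D"
proof -
  have "trace (Q ** D ** transpose Q) = trace (transpose Q ** (Q ** D))"
    by (rule trace_mul_sym)
  also have "\<dots> = trace D"
    using assms by (simp add: matrix_mul_assoc orthogonal_matrix)
  finally show ?thesis .
qed

text \<open>Expresses a spectral integral through matrix entries instead of eigenvalues;
  measurability in the matrix rests on this.\<close>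

lemma trace_matrix_poly:
  fixes A :: "real ^ 'n ^ 'n"
  assumes "transpose A = A"
  shows "trace (matrix_poly p A) = CARD('n) * (\<integral>z. poly p z \<partial>empirical_spectral_distribution A)"
proof -
  obtain Q d where Qd: "orthogonal_matrix Q" "A = Q ** diagonal_matrix d ** transpose Q"
    using symmetric_matrix_diagonalization[OF assms] .
  have "poly p \<in> borel_measurable borel"
    by (intro borel_measurable_continuous_onI continuous_intros)
  then show ?thesis
    by (simp add: matrix_poly_diagonalized[OF Qd] trace_orthogonal_conjugate[OF Qd(1)]
        integral_empirical_spectral_distribution[OF Qd])
      (simp add: trace_def diagonal_matrix_def)
qed

text \<open>\<open>Q\<close> also diagonalizes the Gram matrix, with squared diagonal entries. The
  Gram form is the one in which squared norms arise.\<close>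

lemma trace_gram_matrix_poly:
  fixes A :: "real ^ 'n ^ 'n"
  assumes "transpose A = A"
  shows "trace (transpose (matrix_poly p A) ** matrix_poly p A) =
      CARD('n) * (\<integral>z. (poly p z)\<^sup>2 \<partial>empirical_spectral_distribution A)"
proof -
  obtain Q d where Qd: "orthogonal_matrix Q" "A = Q ** diagonal_matrix d ** transpose Q"
    using symmetric_matrix_diagonalization[OF assms] .
  let ?D = "diagonal_matrix (\<lambda>i. poly p (d i))"
  have sym: "transpose ?D = ?D"
    by (simp add: transpose_def diagonal_matrix_def vec_eq_iff)
  have "transpose (matrix_poly p A) ** matrix_poly p A = Q ** ?D ** (transpose Q ** Q) ** ?D ** transpose Q"
    by (simp add: matrix_poly_diagonalized[OF Qd] matrix_transpose_mul sym matrix_mul_assoc)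
  also have "\<dots> = Q ** diagonal_matrix (\<lambda>i. (poly p (d i))\<^sup>2) ** transpose Q"
    using Qd(1) by (simp add: orthogonal_matrix diagonal_matrix_mult power2_eq_square
        flip: matrix_mul_assoc)
  finally have "trace (transpose (matrix_poly p A) ** matrix_poly p A) = (\<Sum>i\<in>UNIV. (poly p (d i))\<^sup>2)"
    by (simp add: trace_orthogonal_conjugate[OF Qd(1)]) (simp add: trace_def diagonal_matrix_def)
  moreover have "(\<lambda>z. (poly p z)\<^sup>2) \<in> borel_measurable borel"
    by (intro borel_measurable_continuous_onI continuous_intros)
  ultimately show ?thesis
    by (simp add: integral_empirical_spectral_distribution[OF Qd])
qed

text \<open>An entry is the inner product of two columns of \<open>B\<close>, at most half the sum
  of their squared lengths; the trace adds the squared lengths of all columns. It serves to dominate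
  single entries by an integrable function.\<close>

lemma gram_entry_le_trace:
  fixes B :: "real ^ 'n ^ 'n"
  shows "\<bar>(transpose B ** B) $ i $ j\<bar> \<le> trace (transpose B ** B)"
proof -
  have tr: "trace (transpose B ** B) = (\<Sum>k\<in>UNIV. \<Sum>l\<in>UNIV. (B $ l $ k)\<^sup>2)"
    by (simp add: trace_def matrix_matrix_mult_def transpose_def power2_eq_square)
  have row: "(\<Sum>l\<in>UNIV. (B $ l $ k)\<^sup>2) \<le> trace (transpose B ** B)" for k
    unfolding tr by (rule member_le_sum[of k UNIV "\<lambda>k. \<Sum>l\<in>UNIV. (B $ l $ k)\<^sup>2"]) (auto intro: sum_nonneg)
  have "\<bar>(transpose B ** B) $ i $ j\<bar> \<le> (\<Sum>l\<in>UNIV. \<bar>B $ l $ i * B $ l $ j\<bar>)"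
    by (simp add: matrix_matrix_mult_def transpose_def)
  also have "\<dots> \<le> (\<Sum>l\<in>UNIV. ((B $ l $ i)\<^sup>2 + (B $ l $ j)\<^sup>2) / 2)"
  proof (rule sum_mono)
    fix l
    show "\<bar>B $ l $ i * B $ l $ j\<bar> \<le> ((B $ l $ i)\<^sup>2 + (B $ l $ j)\<^sup>2) / 2"
      using sum_squares_bound[of "\<bar>B $ l $ i\<bar>" "\<bar>B $ l $ j\<bar>"] by (simp add: abs_mult)
  qed
  also have "\<dots> = ((\<Sum>l\<in>UNIV. (B $ l $ i)\<^sup>2) + (\<Sum>l\<in>UNIV. (B $ l $ j)\<^sup>2)) / 2"
    by (simp add: sum.distrib flip: sum_divide_distrib)
  also have "\<dots> \<le> trace (transpose B ** B)"
    using row[of i] row[of j] by simp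
  finally show ?thesis .
qed

text \<open>Separates the entries of \<open>r\<close> from those of \<open>B\<close>, so that
  independence can be applied term by term.\<close>

lemma norm_matrix_vector_power2:
  fixes B :: "real ^ 'n ^ 'm"
  shows "(norm (B *v r))\<^sup>2 = (\<Sum>i\<in>UNIV. \<Sum>j\<in>UNIV. r $ i * r $ j * (transpose B ** B) $ i $ j)"
proof -
  have "(norm (B *v r))\<^sup>2 = (B *v r) \<bullet> (B *v r)"
    by (simp add: dot_square_norm)
  also have "\<dots> = r \<bullet> ((transpose B ** B) *v r)"
    by (metis dot_lmul_matrix inner_commute matrix_vector_mul_assoc transpose_matrix_vector)
  also have "\<dots> = (\<Sum>i\<in>UNIV. \<Sum>j\<in>UNIV. r $ i * r $ j * (transpose B ** B) $ i $ j)"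
    by (simp add: inner_vec_def matrix_vector_mult_def sum_distrib_left mult_ac)
  finally show ?thesis .
qed

text \<open>The distribution sits on the eigenvalues, which are positive for a positive definite
  matrix.\<close>

lemma integral_empirical_spectral_distribution_cong:
  fixes A :: "real ^ 'n ^ 'n" and \<phi> \<psi> :: "real \<Rightarrow> real"
  assumes "transpose A = A" "positive_definite A"
    and [measurable]: "\<phi> \<in> borel_measurable borel" "\<psi> \<in> borel_measurable borel"
    and eq: "\<And>z. z > 0 \<Longrightarrow> \<phi> z = \<psi> z"
  shows "(\<integral>z. \<phi> z \<partial>empirical_spectral_distribution A) = (\<integral>z. \<psi> z \<partial>empirical_spectral_distribution A)"
proof -
  obtain Q d where Qd: "orthogonal_matrix Q" "A = Q ** diagonal_matrix d ** transpose Q"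
    using symmetric_matrix_diagonalization[OF assms(1)] .
  have "d i > 0" for i
  proof -
    \<comment> \<open>Column \<open>i\<close> of \<open>Q\<close>, where the quadratic form of
      \<open>A\<close> takes the value \<open>d i\<close>.\<close>
    let ?v = "Q *v axis i 1"
    have tv: "transpose Q *v ?v = axis i 1"
      using Qd(1) by (simp add: matrix_vector_mul_assoc orthogonal_matrix)
    then have "?v \<noteq> 0"
      by (metis axis_eq_0_iff matrix_vector_mult_0_right zero_neq_one)
    then have "0 < ?v \<bullet> (A *v ?v)"
      using assms(2) by (simp add: positive_definite_def)
    also have "A *v ?v = Q *v (diagonal_matrix d *v axis i 1)"
      using tv by (simp add: Qd(2) flip: matrix_vector_mul_assoc)
    also have "?v \<bullet> \<dots> = axis i 1 \<bullet> (diagonal_matrix d *v axis i 1)"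
      using tv by (metis dot_lmul_matrix transpose_matrix_vector)
    also have "\<dots> = d i"
      by (simp add: inner_axis' diagonal_matrix_def matrix_vector_mult_basis column_def)
    finally show ?thesis .
  qed
  then show ?thesis
    using assms(3,4) by (simp add: integral_empirical_spectral_distribution[OF Qd] eq)
qed

section \<open>Expected traces\<close>

lemma borel_measurable_matrix_poly_nth:
  fixes H :: "'a \<Rightarrow> real ^ 'n ^ 'n"
  assumes H: "H \<in> borel_measurable M"
  shows "(\<lambda>\<omega>. matrix_poly p (H \<omega>) $ i $ j) \<in> borel_measurable M"
proof (induction p arbitrary: i j)
  case (pCons c p)
  have [measurable]: "(\<lambda>\<omega>. H \<omega> $ i $ j) \<in> borel_measurable M" for i j
    by (rule measurable_compose[OF H borel_measurable_continuous_onI]) (intro continuous_intros)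
  note [measurable] = pCons.IH
  show ?case
    by (simp add: matrix_matrix_mult_def)
qed simp

lemma polynomial_approximation:
  fixes \<phi> :: "real \<Rightarrow> real"
  assumes "continuous_on UNIV \<phi>" "e > 0"
  shows "\<exists>p. \<forall>z\<in>{a..b}. \<bar>\<phi> z - poly p z\<bar> < e"
proof -
  obtain g where g: "real_polynomial_function g" "\<And>z. z \<in> {a..b} \<Longrightarrow> \<bar>\<phi> z - g z\<bar> < e"
    using Stone_Weierstrass_real_polynomial_function[OF compact_Icc continuous_on_subset[OF assms(1)] assms(2)]
    by (metis subset_UNIV)
  obtain c n where "g = (\<lambda>x. \<Sum>i\<le>n::nat. c i * x ^ i)"
    using real_polynomial_function_imp_sum[OF g(1)] by blast
  then have "g = poly (\<Sum>i\<le>n. monom (c i) i)"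
    by (simp add: fun_eq_iff poly_sum poly_monom)
  with g(2) show ?thesis by blast
qed

text \<open>Avoids a measurable choice of eigenvalues: for polynomials the integral is a normalized
  trace, and a continuous \<open>\<phi>\<close> is a pointwise limit of polynomials. Pointwise
  limits suffice because the integrals are finite averages.\<close>

lemma borel_measurable_integral_empirical_spectral_distribution:
  fixes H :: "'a \<Rightarrow> real ^ 'n ^ 'n" and \<phi> :: "real \<Rightarrow> real"
  assumes H: "H \<in> borel_measurable M" and sym: "\<And>\<omega>. \<omega> \<in> space M \<Longrightarrow> transpose (H \<omega>) = H \<omega>"
    and \<phi>: "continuous_on UNIV \<phi>"
  shows "(\<lambda>\<omega>. \<integral>z. \<phi> z \<partial>empirical_spectral_distribution (H \<omega>)) \<in> borel_measurable M"
proof -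
  \<comment> \<open>One index governs both interval and accuracy, so each fixed \<open>z\<close> is
    eventually covered with error tending to 0.\<close>
  have "\<exists>p. \<forall>z\<in>{- real n..real n}. \<bar>\<phi> z - poly p z\<bar> < inverse (real (Suc n))" for n
    by (rule polynomial_approximation[OF \<phi>]) simp
  then obtain p where p: "\<And>n z. z \<in> {- real n..real n} \<Longrightarrow> \<bar>\<phi> z - poly (p n) z\<bar> < inverse (real (Suc n))"
    by metis
  have lim: "(\<lambda>n. poly (p n) z) \<longlonglongrightarrow> \<phi> z" for z
  proof -
    have "eventually (\<lambda>n. norm (\<phi> z - poly (p n) z) \<le> inverse (real (Suc n))) sequentially"
    proof (rule eventually_sequentiallyI)
      fix n assume "nat \<lceil>\<bar>z\<bar>\<rceil> \<le> n"
      then have "z \<in> {- real n..real n}"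
        by (simp add: nat_le_iff ceiling_le_iff) linarith
      from p[OF this] show "norm (\<phi> z - poly (p n) z) \<le> inverse (real (Suc n))" by simp
    qed
    from Lim_null_comparison[OF this LIMSEQ_inverse_real_of_nat]
    show ?thesis
      using tendsto_diff[OF tendsto_const[of "\<phi> z"], of "\<lambda>n. \<phi> z - poly (p n) z" 0] by simp
  qed
  have [measurable]: "poly q \<in> borel_measurable borel" "\<phi> \<in> borel_measurable borel" for q :: "real poly"
    using \<phi> by (auto intro!: borel_measurable_continuous_onI continuous_intros)
  show ?thesis
  proof (rule borel_measurable_LIMSEQ_metric)
    fix n
    have "(\<lambda>\<omega>. trace (matrix_poly (p n) (H \<omega>)) / CARD('n)) \<in> borel_measurable M"
      unfolding trace_def using borel_measurable_matrix_poly_nth[OF H] by simp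
    then show "(\<lambda>\<omega>. \<integral>z. poly (p n) z \<partial>empirical_spectral_distribution (H \<omega>)) \<in> borel_measurable M"
      by (rule measurable_cong[THEN iffD1, rotated]) (simp add: sym trace_matrix_poly)
  next
    fix \<omega> assume "\<omega> \<in> space M"
    then obtain Q d where Qd: "orthogonal_matrix Q" "H \<omega> = Q ** diagonal_matrix d ** transpose Q"
      using symmetric_matrix_diagonalization[OF sym] by metis
    show "(\<lambda>n. \<integral>z. poly (p n) z \<partial>empirical_spectral_distribution (H \<omega>))
        \<longlonglongrightarrow> (\<integral>z. \<phi> z \<partial>empirical_spectral_distribution (H \<omega>))"
      by (simp add: integral_empirical_spectral_distribution[OF Qd]) (intro tendsto_intros lim, simp)
  qed
qed

section \<open>Transfer of positivity and integrals to the expected distribution\<close>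

text \<open>Test functions supported on the nonpositive half-line have integral 0 against every
  empirical distribution, hence against \<mu>. This makes \<open>weight_measure \<mu>\<close> the
  intended measure.\<close>

lemma expected_spectral_distribution_nonneg:
  fixes H :: "'a \<Rightarrow> real ^ 'n ^ 'n"
  assumes \<mu>: "expected_spectral_distribution M H \<mu>"
    and sym: "\<And>\<omega>. \<omega> \<in> space M \<Longrightarrow> transpose (H \<omega>) = H \<omega>"
    and pd: "\<And>\<omega>. \<omega> \<in> space M \<Longrightarrow> positive_definite (H \<omega>)"
  shows "AE z in \<mu>. 0 \<le> z"
proof -
  interpret \<mu>: real_distribution \<mu>
    using \<mu> by (simp add: expected_spectral_distribution_def)
  \<comment> \<open>Tent functions, positive exactly between \<open>- real n\<close> and 0; together
    they detect every negative point.\<close>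
  define \<phi> where "\<phi> n z = max 0 (min (- z) (real n + z))" for n z
  have cont: "continuous_on UNIV (\<phi> n)" for n
    unfolding \<phi>_def by (intro continuous_intros)
  then have [measurable]: "\<phi> n \<in> borel_measurable borel" for n
    by (rule borel_measurable_continuous_onI)
  have "AE z in \<mu>. \<phi> n z = 0" for n
  proof -
    have "\<forall>z. z \<notin> {- real n..0} \<longrightarrow> \<phi> n z = 0"
      by (auto simp: \<phi>_def)
    then have "(\<integral>z. \<phi> n z \<partial>\<mu>) = (\<integral>\<omega>. (\<integral>z. \<phi> n z \<partial>empirical_spectral_distribution (H \<omega>)) \<partial>M)"
      using \<mu> cont compact_Icc unfolding expected_spectral_distribution_def by blast
    also have "\<dots> = (\<integral>\<omega>. (\<integral>z. 0 \<partial>empirical_spectral_distribution (H \<omega>)) \<partial>M)"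
      using sym pd by (intro Bochner_Integration.integral_cong refl
          integral_empirical_spectral_distribution_cong) (auto simp: \<phi>_def)
    finally have "(\<integral>z. \<phi> n z \<partial>\<mu>) = 0"
      by simp
    moreover have "integrable \<mu> (\<phi> n)"
      by (rule \<mu>.integrable_const_bound[where B = "real n"]) (auto simp: \<phi>_def)
    ultimately show ?thesis
      by (subst (asm) integral_nonneg_eq_0_iff_AE) (auto simp: \<phi>_def)
  qed
  then have "AE z in \<mu>. \<forall>n. \<phi> n z = 0"
    by (simp add: AE_all_countable)
  then show ?thesis
  proof eventually_elim
    fix z assume z: "\<forall>n. \<phi> n z = 0"
    obtain n where "real n > - z"
      using reals_Archimedean2 by blast
    then show "0 \<le> z"
      using z[rule_format, of n] by (simp add: \<phi>_def split: if_splits)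
  qed
qed

text \<open>Extends the identity that defines \<mu> beyond compact support by truncating
  \<open>q\<close>: dominated convergence over \<mu>, monotone convergence over \<open>M\<close>.
  The latter also yields integrability over \<open>M\<close>.\<close>

lemma expected_spectral_distribution_integral:
  fixes H :: "'a \<Rightarrow> real ^ 'n ^ 'n" and q :: "real \<Rightarrow> real"
  assumes "prob_space M" and H: "H \<in> borel_measurable M"
    and sym: "\<And>\<omega>. \<omega> \<in> space M \<Longrightarrow> transpose (H \<omega>) = H \<omega>"
    and \<mu>: "expected_spectral_distribution M H \<mu>"
    and q: "continuous_on UNIV q" "\<And>z. q z \<ge> 0" "integrable \<mu> q"
  shows "has_bochner_integral M (\<lambda>\<omega>. \<integral>z. q z \<partial>empirical_spectral_distribution (H \<omega>)) (\<integral>z. q z \<partial>\<mu>)"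
proof -
  interpret prob_space M by fact
  interpret \<mu>: real_distribution \<mu>
    using \<mu> by (simp add: expected_spectral_distribution_def)
  \<comment> \<open>Cutoffs increasing to 1: \<open>\<kappa> n\<close> is 1 for
    \<open>\<bar>z\<bar> \<le> real n - 1\<close> and 0 for
    \<open>\<bar>z\<bar> \<ge> real n\<close>.\<close>
  define \<kappa> where "\<kappa> n z = max 0 (min 1 (real n - \<bar>z\<bar>))" for n z
  define \<phi> where "\<phi> n z = \<kappa> n z * q z" for n z
  have \<kappa>: "0 \<le> \<kappa> n z" "\<kappa> n z \<le> 1" "n \<le> m \<Longrightarrow> \<kappa> n z \<le> \<kappa> m z" for n m z
    by (auto simp: \<kappa>_def)
  have cont: "continuous_on UNIV (\<phi> n)" for n
    unfolding \<phi>_def \<kappa>_def by (intro continuous_intros q)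
  then have [measurable]: "\<phi> n \<in> borel_measurable borel" for n
    by (rule borel_measurable_continuous_onI)
  have [measurable]: "q \<in> borel_measurable borel"
    using q(1) by (rule borel_measurable_continuous_onI)
  have bound: "\<bar>\<phi> n z\<bar> \<le> q z" for n z
    using \<kappa> q(2) by (simp add: \<phi>_def abs_mult mult_left_le_one_le)
  have mono: "\<phi> n z \<le> \<phi> m z" if "n \<le> m" for n m z
    using \<kappa> q(2) that by (simp add: \<phi>_def mult_right_mono)
  have supp: "\<forall>z. z \<notin> {- real n..real n} \<longrightarrow> \<phi> n z = 0" for n
    by (auto simp: \<phi>_def \<kappa>_def)
  have lim: "(\<lambda>n. \<phi> n z) \<longlonglongrightarrow> q z" for z
  proof (rule tendsto_eventually, rule eventually_sequentiallyI)
    fix n assume "nat \<lceil>\<bar>z\<bar> + 1\<rceil> \<le> n"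
    then have "\<bar>z\<bar> + 1 \<le> real n"
      by linarith
    then show "\<phi> n z = q z"
      by (simp add: \<phi>_def \<kappa>_def)
  qed
  define G :: "(real \<Rightarrow> real) \<Rightarrow> 'a \<Rightarrow> real"
    where "G \<psi> \<omega> = (\<integral>z. \<psi> z \<partial>empirical_spectral_distribution (H \<omega>))" for \<psi> \<omega>
  \<comment> \<open>A single family \<open>d\<close> serves all \<open>\<psi>\<close> at once, so
    different truncations can be compared at the same outcome.\<close>
  have G: "\<exists>d. \<forall>\<psi>\<in>borel_measurable borel. G \<psi> \<omega> = (\<Sum>i\<in>(UNIV :: 'n set). \<psi> (d i)) / CARD('n)"
    if "\<omega> \<in> space M" for \<omega>
    using symmetric_matrix_diagonalization[OF sym[OF that]] integral_empirical_spectral_distribution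
    unfolding G_def by metis
  have meas: "G \<psi> \<in> borel_measurable M" if "continuous_on UNIV \<psi>" for \<psi>
    unfolding G_def using borel_measurable_integral_empirical_spectral_distribution[OF H sym that] .
  have eq: "(\<integral>z. \<phi> n z \<partial>\<mu>) = (\<integral>\<omega>. G (\<phi> n) \<omega> \<partial>M)" for n
    using \<mu> cont supp compact_Icc unfolding expected_spectral_distribution_def G_def by blast
  have "integrable M (G (\<phi> n))" for n
  proof -
    have "compact (\<phi> n ` {- real n..real n})"
      by (intro compact_continuous_image compact_Icc continuous_on_subset[OF cont]) simp
    then obtain C where "\<forall>w\<in>\<phi> n ` {- real n..real n}. norm w \<le> C"
      using compact_imp_bounded bounded_iff by blast
    then have C: "\<bar>\<phi> n z\<bar> \<le> C" if "z \<in> {- real n..real n}" for z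
      using that by auto
    then have C': "\<bar>\<phi> n z\<bar> \<le> \<bar>C\<bar>" for z
      using supp[of n] by (cases "z \<in> {- real n..real n}") force+
    have "norm (G (\<phi> n) \<omega>) \<le> \<bar>C\<bar>" if \<omega>: "\<omega> \<in> space M" for \<omega>
    proof -
      obtain d :: "'n \<Rightarrow> real" where d: "G (\<phi> n) \<omega> = (\<Sum>i\<in>UNIV. \<phi> n (d i)) / CARD('n)"
        using G[OF \<omega>] by force
      have "\<bar>\<Sum>i\<in>UNIV. \<phi> n (d i)\<bar> \<le> CARD('n) * \<bar>C\<bar>"
        using C' by (intro order_trans[OF sum_abs] sum_bounded_above) auto
      then show ?thesis
        by (simp add: d divide_simps mult.commute)
    qed
    then show ?thesis
      using meas[OF cont] by (intro integrable_const_bound) auto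
  qed
  moreover have "AE \<omega> in M. mono (\<lambda>n. G (\<phi> n) \<omega>)"
  proof (rule AE_I2, rule monoI)
    fix \<omega> and n m :: nat assume "\<omega> \<in> space M" "n \<le> m"
    moreover obtain d :: "'n \<Rightarrow> real" where "\<forall>\<psi>\<in>borel_measurable borel. G \<psi> \<omega> = (\<Sum>i\<in>UNIV. \<psi> (d i)) / CARD('n)"
      using G[OF \<open>\<omega> \<in> space M\<close>] by blast
    ultimately show "G (\<phi> n) \<omega> \<le> G (\<phi> m) \<omega>"
      by (simp add: divide_right_mono sum_mono mono)
  qed
  moreover have "AE \<omega> in M. (\<lambda>n. G (\<phi> n) \<omega>) \<longlonglongrightarrow> G q \<omega>"
  proof (rule AE_I2)
    fix \<omega> assume "\<omega> \<in> space M"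
    then obtain d :: "'n \<Rightarrow> real" where "\<forall>\<psi>\<in>borel_measurable borel. G \<psi> \<omega> = (\<Sum>i\<in>UNIV. \<psi> (d i)) / CARD('n)"
      using G by blast
    then show "(\<lambda>n. G (\<phi> n) \<omega>) \<longlonglongrightarrow> G q \<omega>"
      by (simp add: lim tendsto_divide tendsto_sum)
  qed
  moreover have "(\<lambda>n. \<integral>\<omega>. G (\<phi> n) \<omega> \<partial>M) \<longlonglongrightarrow> (\<integral>z. q z \<partial>\<mu>)"
    unfolding eq[symmetric]
    by (rule integral_dominated_convergence[where w = q]) (auto simp: q bound lim)
  ultimately show ?thesis
    using has_bochner_integral_monotone_convergence[of M "\<lambda>n. G (\<phi> n)" "G q"] meas[OF q(1)]
    unfolding G_def by blast
qed

section \<open>Independence and the expected squared error\<close>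

text \<open>The preimages under a composition are among those under \<open>X\<close> or
  \<open>Y\<close>, and families closed under intersection stay independent after generating
  sigma-algebras. Real-valued \<open>g\<close> and \<open>h\<close> provide the common codomain that
  \<open>indep_var\<close> requires.\<close>

lemma independent_variables_compose:
  fixes g h :: "_ \<Rightarrow> real"
  assumes "prob_space M" and X: "X \<in> borel_measurable M" and Y: "Y \<in> borel_measurable M"
    and indep: "independent_variables M X Y"
    and g: "g \<in> borel_measurable borel" and h: "h \<in> borel_measurable borel"
  shows "prob_space.indep_var M borel (\<lambda>\<omega>. g (X \<omega>)) borel (\<lambda>\<omega>. h (Y \<omega>))"
proof -
  interpret prob_space M by fact
  have vimage: "\<exists>B\<in>sets borel. (\<lambda>\<omega>. k (Z \<omega>)) -` A \<inter> space M = Z -` B \<inter> space M"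
    if "k \<in> borel_measurable borel" "A \<in> sets borel" for k :: "_ \<Rightarrow> real" and Z A
    using measurable_sets_borel[OF that] by (intro bexI[of _ "k -` A"]) auto
  have Int_stable: "Int_stable {Z -` A \<inter> space M |A. A \<in> sets borel}" for Z :: "_ \<Rightarrow> real"
  proof (rule Int_stableI, safe)
    fix A B :: "real set" assume "A \<in> sets borel" "B \<in> sets borel"
    then show "\<exists>C. (Z -` A \<inter> space M) \<inter> (Z -` B \<inter> space M) = Z -` C \<inter> space M \<and> C \<in> sets borel"
      by (intro exI[of _ "A \<inter> B"]) auto
  qed
  have subset: "{(\<lambda>\<omega>. k (Z \<omega>)) -` A \<inter> space M |A. A \<in> sets borel} \<subseteq> {Z -` B \<inter> space M |B. B \<in> sets borel}"
    if "k \<in> borel_measurable borel" for k :: "_ \<Rightarrow> real" and Z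
    using vimage[OF that, of _ Z] by blast
  have "indep_set {(\<lambda>\<omega>. g (X \<omega>)) -` A \<inter> space M |A. A \<in> sets borel}
      {(\<lambda>\<omega>. h (Y \<omega>)) -` A \<inter> space M |A. A \<in> sets borel}"
    using indep subset[OF g, of X] subset[OF h, of Y]
    unfolding independent_variables_def indep_sets2_eq by (meson order_trans subsetD)
  then show ?thesis
    unfolding indep_var_eq using measurable_compose[OF X g] measurable_compose[OF Y h]
    by (intro conjI indep_set_sigma_sets Int_stable) auto
qed

text \<open>Expand the squared norm into entries. Independence factors each expectation and isotropy
  keeps only the diagonal terms, leaving \<open>R\<^sup>2\<close> times an expected trace; the trace
  brings in the dimension.\<close>

theorem expectation_norm_matrix_poly:
  fixes H :: "'a \<Rightarrow> real ^ 'n ^ 'n" and r :: "'a \<Rightarrow> real ^ 'n"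
  assumes "prob_space M" and H: "H \<in> borel_measurable M" and r: "r \<in> borel_measurable M"
    and sym: "\<And>\<omega>. \<omega> \<in> space M \<Longrightarrow> transpose (H \<omega>) = H \<omega>"
    and \<mu>: "expected_spectral_distribution M H \<mu>"
    and indep: "independent_variables M r H"
    and cov: "has_bochner_integral M (\<lambda>\<omega>. outer_product (r \<omega>) (r \<omega>)) (R\<^sup>2 *\<^sub>R mat 1)"
    and int: "integrable \<mu> (\<lambda>z. (poly p z)\<^sup>2)"
  shows "(\<integral>\<omega>. (norm (matrix_poly p (H \<omega>) *v r \<omega>))\<^sup>2 \<partial>M) = real CARD('n) * R\<^sup>2 * (\<integral>z. (poly p z)\<^sup>2 \<partial>\<mu>)"
proof -
  interpret prob_space M by fact
  define W where "W A = transpose (matrix_poly p A) ** matrix_poly p A" for A :: "real ^ 'n ^ 'n"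
  have W_meas: "(\<lambda>A. W A $ i $ j) \<in> borel_measurable borel" for i j
    unfolding W_def matrix_matrix_mult_def transpose_def
    using borel_measurable_matrix_poly_nth[of "\<lambda>A. A" borel p]
    by (auto intro!: borel_measurable_sum borel_measurable_times)
  have W_meas_H: "(\<lambda>\<omega>. W (H \<omega>) $ i $ j) \<in> borel_measurable M" for i j
    using measurable_compose[OF H W_meas] .
  have "has_bochner_integral M (\<lambda>\<omega>. \<integral>z. (poly p z)\<^sup>2 \<partial>empirical_spectral_distribution (H \<omega>))
      (\<integral>z. (poly p z)\<^sup>2 \<partial>\<mu>)"
    using assms by (intro expected_spectral_distribution_integral continuous_intros) auto
  then have "has_bochner_integral M (\<lambda>\<omega>. CARD('n) * (\<integral>z. (poly p z)\<^sup>2 \<partial>empirical_spectral_distribution (H \<omega>)))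
      (CARD('n) * (\<integral>z. (poly p z)\<^sup>2 \<partial>\<mu>))"
    by (intro has_bochner_integral_mult_right) auto
  then have trace: "has_bochner_integral M (\<lambda>\<omega>. trace (W (H \<omega>))) (CARD('n) * (\<integral>z. (poly p z)\<^sup>2 \<partial>\<mu>))"
    by (rule has_bochner_integral_cong[THEN iffD1, rotated 3])
      (simp_all add: W_def trace_gram_matrix_poly sym)
  \<comment> \<open>The product rule for independent variables needs integrable factors; the entries
    are dominated by the trace.\<close>
  have W_int: "integrable M (\<lambda>\<omega>. W (H \<omega>) $ i $ j)" for i j
  proof (rule Bochner_Integration.integrable_bound)
    show "integrable M (\<lambda>\<omega>. trace (W (H \<omega>)))"
      using trace by (rule integrable.intros)
    show "AE \<omega> in M. norm (W (H \<omega>) $ i $ j) \<le> norm (trace (W (H \<omega>)))"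
      unfolding W_def by (intro AE_I2) (simp add: order_trans[OF gram_entry_le_trace abs_ge_self])
  qed (rule W_meas_H)
  have r_cov: "has_bochner_integral M (\<lambda>\<omega>. r \<omega> $ i * r \<omega> $ j) (if i = j then R\<^sup>2 else 0)" for i j
  proof -
    have "bounded_linear (\<lambda>A :: real ^ 'n ^ 'n. A $ i $ j)"
      by (intro bounded_linear_compose[OF bounded_linear_vec_nth bounded_linear_vec_nth])
    from has_bochner_integral_bounded_linear[OF this cov] show ?thesis
      by (simp add: outer_product_def mat_def if_distrib cong: if_cong)
  qed
  have "has_bochner_integral M (\<lambda>\<omega>. r \<omega> $ i * r \<omega> $ j * W (H \<omega>) $ i $ j)
      ((if i = j then R\<^sup>2 else 0) * (\<integral>\<omega>. W (H \<omega>) $ i $ j \<partial>M))" for i j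
  proof -
    have "indep_var borel (\<lambda>\<omega>. r \<omega> $ i * r \<omega> $ j) borel (\<lambda>\<omega>. W (H \<omega>) $ i $ j)"
      by (rule independent_variables_compose[OF \<open>prob_space M\<close> r H indep _ W_meas])
        (intro borel_measurable_continuous_onI continuous_intros)
    then show ?thesis
      using indep_var_lebesgue_integral[OF _ integrable.intros[OF r_cov] W_int]
        indep_var_integrable[OF _ integrable.intros[OF r_cov] W_int]
      by (simp add: has_bochner_integral_iff has_bochner_integral_integral_eq[OF r_cov])
  qed
  \<comment> \<open>Keeping \<open>has_bochner_integral\<close> shows that the squared error is
    integrable, so its integral is not the default value 0.\<close>
  then have "has_bochner_integral M (\<lambda>\<omega>. \<Sum>i\<in>UNIV. \<Sum>j\<in>UNIV. r \<omega> $ i * r \<omega> $ j * W (H \<omega>) $ i $ j)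
      (\<Sum>i\<in>UNIV. \<Sum>j\<in>UNIV. (if i = j then R\<^sup>2 else 0) * (\<integral>\<omega>. W (H \<omega>) $ i $ j \<partial>M))"
    by (intro has_bochner_integral_sum)
  then have "(\<integral>\<omega>. (norm (matrix_poly p (H \<omega>) *v r \<omega>))\<^sup>2 \<partial>M)
      = (\<Sum>i\<in>UNIV. \<Sum>j\<in>UNIV. (if i = j then R\<^sup>2 else 0) * (\<integral>\<omega>. W (H \<omega>) $ i $ j \<partial>M))"
    unfolding norm_matrix_vector_power2 W_def by (rule has_bochner_integral_integral_eq)
  also have "\<dots> = (\<Sum>i\<in>UNIV. R\<^sup>2 * (\<integral>\<omega>. W (H \<omega>) $ i $ i \<partial>M))"
    by (intro sum.cong refl) (simp add: if_distribR if_distrib[of "\<lambda>x. x * _"] sum.delta cong: if_cong)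
  also have "\<dots> = R\<^sup>2 * (\<integral>\<omega>. trace (W (H \<omega>)) \<partial>M)"
    using W_int by (simp add: trace_def sum_distrib_left)
  also have "\<dots> = real CARD('n) * R\<^sup>2 * (\<integral>z. (poly p z)\<^sup>2 \<partial>\<mu>)"
    by (simp add: has_bochner_integral_integral_eq[OF trace])
  finally show ?thesis .
qed

section \<open>Residual polynomials of first-order methods\<close>

text \<open>As \<open>grad\<close> is a definite description, uniqueness of the derivative is part
  of the proof. Symmetry of \<open>A\<close> merges the two terms of the product rule and cancels
  the factor 1/2.\<close>

lemma grad_quadratic_objective:
  assumes "transpose A = A"
  shows "grad (quadratic_objective A z) x = A *v (x - z)"
proof -
  have "(quadratic_objective A z has_derivative
      (\<lambda>h. 1 / 2 * ((x - z) \<bullet> (A *v (h - 0)) + (h - 0) \<bullet> (A *v (x - z))))) (at x)"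
    unfolding quadratic_objective_def
    by (intro has_derivative_mult_right has_derivative_inner has_derivative_diff has_derivative_ident
        has_derivative_const bounded_linear.has_derivative[OF matrix_vector_mul_bounded_linear])
  moreover have "(x - z) \<bullet> (A *v h) = h \<bullet> (A *v (x - z))" for h
    using assms by (metis dot_lmul_matrix inner_commute transpose_matrix_vector)
  ultimately have D: "GDERIV (quadratic_objective A z) x :> A *v (x - z)"
    by (simp add: gderiv_def)
  have "D = A *v (x - z)" if "GDERIV (quadratic_objective A z) x :> D" for D
    using has_derivative_unique[OF D[unfolded gderiv_def] that[unfolded gderiv_def]]
    by (metis vector_eq_ldot inner_commute)
  with D show ?thesis
    unfolding grad_def by (rule the_equality)
qed

lemma matrix_poly_pCons_0_mult_vec: "matrix_poly (pCons 0 p) A *v r = A *v (matrix_poly p A *v r)"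
  by (simp add: matrix_vector_mul_assoc)

lemma matrix_sum_mult_vec:
  fixes B :: "'i \<Rightarrow> real ^ 'n ^ 'm"
  shows "(\<Sum>i\<in>I. B i) *v r = (\<Sum>i\<in>I. B i *v r)"
  by (induction I rule: infinite_finite_induct) (simp_all add: matrix_vector_mult_add_rdistrib)

text \<open>Strong induction, each step using all earlier residual polynomials. The coefficients are
  fixed before the outcome, so one \<open>p\<close> works for every \<open>\<omega>\<close>.\<close>

lemma oblivious_first_order_method_residual:
  fixes H :: "'a \<Rightarrow> real ^ 'n ^ 'n"
  assumes sym: "\<And>\<omega>. \<omega> \<in> space M \<Longrightarrow> transpose (H \<omega>) = H \<omega>"
    and y: "oblivious_first_order_method M (\<lambda>\<omega>. quadratic_objective (H \<omega>) (z \<omega>)) x0 y"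
  obtains p where "degree p \<le> t" "poly p 0 = 1"
    "\<And>\<omega>. \<omega> \<in> space M \<Longrightarrow> y t \<omega> - z \<omega> = matrix_poly p (H \<omega>) *v (x0 \<omega> - z \<omega>)"
proof -
  obtain c where y0: "\<And>\<omega>. \<omega> \<in> space M \<Longrightarrow> y 0 \<omega> = x0 \<omega>"
    and ySuc: "\<And>\<omega> t. \<omega> \<in> space M \<Longrightarrow> y (Suc t) \<omega> = x0 \<omega> +
      (\<Sum>s\<le>t. c t s *\<^sub>R grad (quadratic_objective (H \<omega>) (z \<omega>)) (y s \<omega>))"
    using y unfolding oblivious_first_order_method_def by metis
  define residual where "residual t p \<longleftrightarrow> degree p \<le> t \<and> poly p 0 = 1 \<and>
    (\<forall>\<omega>\<in>space M. y t \<omega> - z \<omega> = matrix_poly p (H \<omega>) *v (x0 \<omega> - z \<omega>))" for t p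
  have "\<exists>p. residual t p"
  proof (induction t rule: less_induct)
    case (less t)
    show ?case
    proof (cases t)
      case 0
      then show ?thesis
        using y0 by (intro exI[of _ 1]) (simp add: residual_def)
    next
      case (Suc u)
      obtain p where p: "\<And>s. s \<le> u \<Longrightarrow> residual s (p s)"
        using less.IH unfolding Suc less_Suc_eq_le by metis
      \<comment> \<open>Each gradient applies \<open>H \<omega>\<close> to an earlier error, hence
        \<open>pCons 0\<close>: it raises the degree by at most one and contributes 0 at the
        origin.\<close>
      define q where "q = 1 + (\<Sum>s\<le>u. smult (c u s) (pCons 0 (p s)))"
      have "degree (smult (c u s) (pCons 0 (p s))) \<le> Suc u" if "s \<le> u" for s
        using p[OF that] that order_trans[OF degree_smult_le degree_pCons_le]
        unfolding residual_def by (meson Suc_le_mono order_trans)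
      then have "degree q \<le> Suc u"
        unfolding q_def by (intro degree_add_le degree_sum_le) auto
      moreover have "poly q 0 = 1"
        by (simp add: q_def poly_sum)
      moreover have "y (Suc u) \<omega> - z \<omega> = matrix_poly q (H \<omega>) *v (x0 \<omega> - z \<omega>)"
        if "\<omega> \<in> space M" for \<omega>
      proof -
        have "matrix_poly q (H \<omega>) *v (x0 \<omega> - z \<omega>) = (x0 \<omega> - z \<omega>) +
            (\<Sum>s\<le>u. c u s *\<^sub>R (H \<omega> *v (matrix_poly (p s) (H \<omega>) *v (x0 \<omega> - z \<omega>))))"
          unfolding q_def matrix_poly_add matrix_poly_sum matrix_vector_mult_add_rdistrib
            matrix_sum_mult_vec matrix_poly_smult scaleR_matrix_vector_assoc[symmetric]
            matrix_poly_pCons_0_mult_vec by simp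
        also have "\<dots> = (x0 \<omega> - z \<omega>) + (\<Sum>s\<le>u. c u s *\<^sub>R (H \<omega> *v (y s \<omega> - z \<omega>)))"
          using p that unfolding residual_def by simp
        also have "\<dots> = y (Suc u) \<omega> - z \<omega>"
          by (simp add: ySuc[OF that] grad_quadratic_objective[OF sym[OF that]])
        finally show ?thesis by simp
      qed
      ultimately show ?thesis
        unfolding Suc residual_def by blast
    qed
  qed
  then show thesis
    using that unfolding residual_def by blast
qed

section \<open>The momentum method as an oblivious first-order method\<close>

text \<open>The weight of gradient \<open>s\<close> in iterate \<open>t\<close>, found by unrolling
  the momentum recursion; the newest gradient enters only through \<open>b\<close>.\<close>

fun momentum_coeffs :: "(nat \<Rightarrow> real) \<Rightarrow> (nat \<Rightarrow> real) \<Rightarrow> nat \<Rightarrow> nat \<Rightarrow> real" where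
  "momentum_coeffs a b 0 s = 0"
| "momentum_coeffs a b (Suc 0) s = (if s = 0 then b 1 else 0)"
| "momentum_coeffs a b (Suc (Suc t)) s =
     a (Suc (Suc t)) * momentum_coeffs a b (Suc t) s + (1 - a (Suc (Suc t))) * momentum_coeffs a b t s +
     (if s = Suc t then b (Suc (Suc t)) else 0)"

lemma momentum_coeffs_eq_0: "t \<le> s \<Longrightarrow> momentum_coeffs a b t s = 0"
  by (induction a b t s rule: momentum_coeffs.induct) auto

text \<open>The two previous iterates are mixed with weights \<open>a\<close> and
  \<open>1 - a\<close>, of sum 1, so \<open>x0\<close> keeps the coefficient 1.\<close>

lemma momentum_iterates_eq_sum:
  "momentum_iterates a b f x0 t =
    x0 + (\<Sum>s<t. momentum_coeffs a b t s *\<^sub>R grad f (momentum_iterates a b f x0 s))"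
proof (induction t rule: induct_nat_012)
  case (ge2 t)
  define g where "g s = grad f (momentum_iterates a b f x0 s)" for s
  let ?k = "momentum_coeffs a b"
  \<comment> \<open>Padded with a zero coefficient, so that both iterates are sums over the same
    gradients.\<close>
  have t: "momentum_iterates a b f x0 t = x0 + (\<Sum>s<Suc t. ?k t s *\<^sub>R g s)"
    using ge2(1) by (simp add: g_def momentum_coeffs_eq_0)
  have Suc_t: "momentum_iterates a b f x0 (Suc t) = x0 + (\<Sum>s<Suc t. ?k (Suc t) s *\<^sub>R g s)"
    using ge2(2) by (simp add: g_def)
  have "(\<Sum>s<Suc (Suc t). ?k (Suc (Suc t)) s *\<^sub>R g s) =
      (\<Sum>s<Suc t. ?k (Suc (Suc t)) s *\<^sub>R g s) + b (Suc (Suc t)) *\<^sub>R g (Suc t)"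
    by (subst sum.lessThan_Suc) (simp add: momentum_coeffs_eq_0)
  also have "(\<Sum>s<Suc t. ?k (Suc (Suc t)) s *\<^sub>R g s) =
      (\<Sum>s<Suc t. a (Suc (Suc t)) *\<^sub>R ?k (Suc t) s *\<^sub>R g s + (1 - a (Suc (Suc t))) *\<^sub>R ?k t s *\<^sub>R g s)"
    by (rule sum.cong) (auto simp: scaleR_left_distrib)
  also have "\<dots> = a (Suc (Suc t)) *\<^sub>R (\<Sum>s<Suc t. ?k (Suc t) s *\<^sub>R g s) +
      (1 - a (Suc (Suc t))) *\<^sub>R (\<Sum>s<Suc t. ?k t s *\<^sub>R g s)"
    by (simp only: sum.distrib scaleR_sum_right)
  finally have "x0 + (\<Sum>s<Suc (Suc t). ?k (Suc (Suc t)) s *\<^sub>R g s) =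
      momentum_iterates a b f x0 (Suc (Suc t))"
    using t Suc_t by (simp add: Let_def g_def[of "Suc t"] algebra_simps)
  then show ?case
    by (simp only: g_def)
qed simp_all

lemma oblivious_first_order_method_momentum:
  "oblivious_first_order_method M f x0 (\<lambda>t \<omega>. momentum_iterates a b (f \<omega>) (x0 \<omega>) t)"
proof -
  define k where "k t = momentum_coeffs a b (Suc t)" for t
  have step: "momentum_iterates a b (f \<omega>) (x0 \<omega>) (Suc t) =
      x0 \<omega> + (\<Sum>s\<le>t. k t s *\<^sub>R grad (f \<omega>) (momentum_iterates a b (f \<omega>) (x0 \<omega>) s))" for t \<omega>
    unfolding k_def by (subst momentum_iterates_eq_sum) (simp only: lessThan_Suc_atMost)
  have "first_order_iterates (f \<omega>) (momentum_iterates a b (f \<omega>) (x0 \<omega>))" for \<omega>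
    unfolding first_order_iterates_def step momentum_iterates.simps(1)
    by (intro allI imageI span_sum span_scale span_base) simp_all
  then show ?thesis
    unfolding oblivious_first_order_method_def using step by auto
qed

text \<open>The errors obey the three-term recurrence with multiplication by the variable replaced
  by \<open>A\<close>, which is the action of the gradient.\<close>

lemma momentum_iterates_residual:
  assumes sym: "transpose A = A" and P0: "P 0 = 1" and P: "three_term_coefficients P a b"
  shows "momentum_iterates a b (quadratic_objective A z) x0 t - z = matrix_poly (P t) A *v (x0 - z)"
proof (induction t rule: induct_nat_012)
  case 0
  show ?case by (simp add: P0)
next
  case 1
  have "P 1 = 1 + smult (b 1) (pCons 0 1)"
    using P by (simp add: three_term_coefficients_def P0 one_pCons)
  then have "matrix_poly (P 1) A *v (x0 - z) = (x0 - z) + b 1 *\<^sub>R (A *v (x0 - z))"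
    by (simp only: matrix_poly_add matrix_poly_smult matrix_vector_mult_add_rdistrib
        matrix_poly_pCons_0_mult_vec matrix_poly_1 matrix_vector_mul_lid flip: scaleR_matrix_vector_assoc)
  then show ?case
    by (simp add: grad_quadratic_objective[OF sym])
next
  case (ge2 t)
  let ?a = "a (Suc (Suc t))" and ?b = "b (Suc (Suc t))"
  have "P (Suc (Suc t)) = smult ?a (P (Suc t)) + smult ?b (pCons 0 (P (Suc t))) + smult (1 - ?a) (P t)"
    using P by (simp add: three_term_coefficients_def)
  then have "matrix_poly (P (Suc (Suc t))) A *v (x0 - z) =
      ?a *\<^sub>R (matrix_poly (P (Suc t)) A *v (x0 - z)) +
      ?b *\<^sub>R (A *v (matrix_poly (P (Suc t)) A *v (x0 - z))) +
      (1 - ?a) *\<^sub>R (matrix_poly (P t) A *v (x0 - z))"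
    by (simp only: matrix_poly_add matrix_poly_smult matrix_vector_mult_add_rdistrib
        matrix_poly_pCons_0_mult_vec flip: scaleR_matrix_vector_assoc)
  then show ?case
    by (simp add: Let_def grad_quadratic_objective[OF sym] flip: ge2) (simp add: algebra_simps)
qed

section \<open>Extremality of residual orthogonal polynomials\<close>

text \<open>Induction on \<open>n\<close>, removing the top coefficient of \<open>S\<close> by a
  multiple of \<open>P n\<close>. The bound is on coefficients rather than on the degree so that
  \<open>n = 0\<close> means \<open>S = 0\<close>.\<close>

lemma orthogonal_polynomials_lower_degree:
  assumes P: "orthogonal_polynomials \<nu> P" and "n \<le> t" "\<And>i. i \<ge> n \<Longrightarrow> coeff S i = 0"
  shows "(\<integral>x. poly (P t) x * poly S x \<partial>\<nu>) = 0"
  using assms(2,3)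
proof (induction n arbitrary: S)
  case 0
  then have "S = 0" by (simp add: poly_eq_iff)
  then show ?case by simp
next
  case (Suc n)
  have int: "integrable \<nu> (\<lambda>x. poly p x * poly q x)" for p q
    using P unfolding orthogonal_polynomials_def poly_mult[symmetric] by blast
  have deg: "degree (P n) = n" and pos: "(\<integral>x. (poly (P n) x)\<^sup>2 \<partial>\<nu>) > 0"
    using P by (auto simp: orthogonal_polynomials_def)
  have lead: "coeff (P n) n \<noteq> 0"
  proof -
    have "P n \<noteq> 0"
      using pos by auto
    then show ?thesis
      using deg leading_coeff_0_iff by metis
  qed
  define c where "c = coeff S n / coeff (P n) n"
  have "coeff (S - smult c (P n)) i = 0" if "i \<ge> n" for i
    using that lead Suc.prems(2)[of i] coeff_eq_0[of "P n" i] deg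
    by (cases "i = n") (auto simp: c_def)
  then have "(\<integral>x. poly (P t) x * poly (S - smult c (P n)) x \<partial>\<nu>) = 0"
    using Suc.prems(1) by (intro Suc.IH) auto
  moreover have "(\<integral>x. poly (P t) x * poly (P n) x \<partial>\<nu>) = 0"
    using P Suc.prems(1) by (auto simp: orthogonal_polynomials_def)
  moreover have "(\<lambda>x. poly (P t) x * poly S x) =
      (\<lambda>x. poly (P t) x * poly (S - smult c (P n)) x + c * (poly (P t) x * poly (P n) x))"
    by (simp add: fun_eq_iff algebra_simps)
  ultimately show ?case
    using int[of "P t" "S - smult c (P n)"] int[of "P t" "P n"] by simp
qed

section \<open>Integration against the weight measure\<close>

context
  fixes \<mu> :: "real measure"
  assumes \<mu>: "real_distribution \<mu>" and nonneg: "AE z in \<mu>. 0 \<le> z"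
begin

interpretation real_distribution \<mu>
  by (rule \<mu>)

lemma integrable_weight_measure_iff:
  assumes "g \<in> borel_measurable borel"
  shows "integrable (weight_measure \<mu>) g \<longleftrightarrow> integrable \<mu> (\<lambda>z. z * g z :: real)"
  unfolding weight_measure_def using assms nonneg by (subst integrable_density) auto

lemma integral_weight_measure:
  fixes g :: "real \<Rightarrow> real"
  assumes "g \<in> borel_measurable borel"
  shows "(\<integral>z. g z \<partial>weight_measure \<mu>) = (\<integral>z. z * g z \<partial>\<mu>)"
  unfolding weight_measure_def using assms nonneg by (subst integral_density) auto

lemma borel_measurable_poly:
  fixes p :: "real poly"
  shows "poly p \<in> borel_measurable borel"
  by (intro borel_measurable_continuous_onI continuous_intros)

text \<open>Positive-order moments of \<mu> are moments of the weight measure, and the constant term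
  is integrable against a probability measure.\<close>

lemma orthogonal_polynomials_weight_measure_integrable:
  assumes "orthogonal_polynomials (weight_measure \<mu>) P"
  shows "integrable \<mu> (poly q)"
proof (cases q)
  case (pCons c p)
  have "integrable \<mu> (\<lambda>z. c + z * poly p z)"
    using assms by (auto simp: orthogonal_polynomials_def integrable_weight_measure_iff borel_measurable_poly)
  then show ?thesis
    unfolding pCons by (simp add: poly_pCons[abs_def])
qed

text \<open>Write \<open>p\<close> as 1 plus the variable times \<open>s\<close>. The variable turns
  \<mu> into the weight measure, for which \<open>P t\<close> is orthogonal to
  \<open>s\<close>.\<close>

lemma residual_orthogonal_polynomials_weight_measure:
  assumes P: "residual_orthogonal_polynomials (weight_measure \<mu>) P"
    and p: "degree p \<le> t" "poly p 0 = 1"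
  shows "(\<integral>z. poly (P t) z * poly p z \<partial>\<mu>) = (\<integral>z. poly (P t) z \<partial>\<mu>)"
proof -
  have orth: "orthogonal_polynomials (weight_measure \<mu>) P"
    using P by (simp add: residual_orthogonal_polynomials_def)
  note int = orthogonal_polynomials_weight_measure_integrable[OF orth]
  obtain c s where p_eq: "p = pCons c s" by (cases p)
  have c: "c = 1"
    using p(2) by (simp add: p_eq)
  \<comment> \<open>Dividing by the variable shifts the coefficients by one; for
    \<open>t = 0\<close> this says \<open>s = 0\<close>.\<close>
  have "coeff s i = 0" if "i \<ge> t" for i
    using that p(1) coeff_eq_0[of p "Suc i"] by (simp add: p_eq)
  then have "(\<integral>z. poly (P t * s) z \<partial>weight_measure \<mu>) = 0"
    using orthogonal_polynomials_lower_degree[OF orth order_refl] by simp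
  then have "(\<integral>z. poly (pCons 0 (P t * s)) z \<partial>\<mu>) = 0"
    by (subst (asm) integral_weight_measure) (simp_all only: borel_measurable_poly poly_pCons, simp)
  moreover have "(\<integral>z. poly (P t) z * poly p z \<partial>\<mu>) =
      (\<integral>z. poly (P t) z + poly (pCons 0 (P t * s)) z \<partial>\<mu>)"
    by (simp add: p_eq c algebra_simps)
  moreover have "\<dots> = (\<integral>z. poly (P t) z \<partial>\<mu>) + (\<integral>z. poly (pCons 0 (P t * s)) z \<partial>\<mu>)"
    by (intro Bochner_Integration.integral_add int)
  ultimately show ?thesis
    by simp
qed

text \<open>The case \<open>p = P t\<close>; it is why the error formula integrates
  \<open>P t\<close> rather than its square.\<close>

lemma residual_orthogonal_polynomials_integral_square:
  assumes P: "residual_orthogonal_polynomials (weight_measure \<mu>) P"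
  shows "(\<integral>z. (poly (P t) z)\<^sup>2 \<partial>\<mu>) = (\<integral>z. poly (P t) z \<partial>\<mu>)"
  using residual_orthogonal_polynomials_weight_measure[OF P, of "P t" t] P
  by (simp add: residual_orthogonal_polynomials_def orthogonal_polynomials_def power2_eq_square)

lemma residual_orthogonal_polynomials_minimal:
  assumes P: "residual_orthogonal_polynomials (weight_measure \<mu>) P"
    and p: "degree p \<le> t" "poly p 0 = 1"
  shows "(\<integral>z. (poly (P t) z)\<^sup>2 \<partial>\<mu>) \<le> (\<integral>z. (poly p z)\<^sup>2 \<partial>\<mu>)"
proof -
  have int: "integrable \<mu> (poly q)" for q
    using P orthogonal_polynomials_weight_measure_integrable
    unfolding residual_orthogonal_polynomials_def by blast
  have int_mult: "integrable \<mu> (\<lambda>z. poly q z * poly s z)" for q s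
    using int unfolding poly_mult[symmetric] by blast
  have "0 \<le> (\<integral>z. (poly p z - poly (P t) z)\<^sup>2 \<partial>\<mu>)"
    by simp
  also have "\<dots> = (\<integral>z. (poly p z)\<^sup>2 - 2 * (poly (P t) z * poly p z) + (poly (P t) z)\<^sup>2 \<partial>\<mu>)"
    by (simp add: power2_diff algebra_simps)
  also have "\<dots> = (\<integral>z. (poly p z)\<^sup>2 \<partial>\<mu>) - 2 * (\<integral>z. poly (P t) z * poly p z \<partial>\<mu>) + (\<integral>z. (poly (P t) z)\<^sup>2 \<partial>\<mu>)"
    using int_mult by (simp add: power2_eq_square)
  finally show ?thesis
    using residual_orthogonal_polynomials_weight_measure[OF P p]
      residual_orthogonal_polynomials_integral_square[OF P, of t] by simp
qed

end

section \<open>Optimality of the momentum method\<close>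

text \<open>The factor \<open>CARD('n)\<close> is the trace of the identity: \<mu> has total mass 1,
  whereas the second moment matrix has trace \<open>CARD('n) * R\<^sup>2\<close>.\<close>

theorem theorem10:
  fixes M :: "'a measure"
    and H :: "'a \<Rightarrow> real ^ 'n ^ 'n"
    and x0 xstar :: "'a \<Rightarrow> real ^ 'n"
    and \<mu> :: "real measure"
    and R :: real
    and P :: "nat \<Rightarrow> real poly"
    and a b :: "nat \<Rightarrow> real"
    and f :: "'a \<Rightarrow> real ^ 'n \<Rightarrow> real"
    and x :: "nat \<Rightarrow> 'a \<Rightarrow> real ^ 'n"
  assumes "prob_space M"
    and "H \<in> borel_measurable M"
    and "x0 \<in> borel_measurable M"
    and "xstar \<in> borel_measurable M"
    and "\<And>\<omega>. \<omega> \<in> space M \<Longrightarrow> transpose (H \<omega>) = H \<omega>"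
    and "\<And>\<omega>. \<omega> \<in> space M \<Longrightarrow> positive_definite (H \<omega>)"
    and "expected_spectral_distribution M H \<mu>"
    and "independent_variables M (\<lambda>\<omega>. x0 \<omega> - xstar \<omega>) H"
    and "has_bochner_integral M (\<lambda>\<omega>. outer_product (x0 \<omega> - xstar \<omega>) (x0 \<omega> - xstar \<omega>))
           (R\<^sup>2 *\<^sub>R mat 1)"
    and "residual_orthogonal_polynomials (weight_measure \<mu>) P"
    and "three_term_coefficients P a b"
    and "f = (\<lambda>\<omega>. quadratic_objective (H \<omega>) (xstar \<omega>))"
    and "x = (\<lambda>t \<omega>. momentum_iterates a b (f \<omega>) (x0 \<omega>) t)"
  shows "oblivious_first_order_method M f x0 x \<and>
         (\<forall>y t. oblivious_first_order_method M f x0 y \<longrightarrow>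
            (\<integral>\<omega>. (norm (x t \<omega> - xstar \<omega>))\<^sup>2 \<partial>M)
              \<le> (\<integral>\<omega>. (norm (y t \<omega> - xstar \<omega>))\<^sup>2 \<partial>M)) \<and>
         (\<forall>t. (\<integral>\<omega>. (norm (x t \<omega> - xstar \<omega>))\<^sup>2 \<partial>M)
            = real CARD('n) * R\<^sup>2 * (\<integral>z. poly (P t) z \<partial>\<mu>))"
proof -
  note sym = assms(5) and P = assms(10)
  have \<mu>: "real_distribution \<mu>"
    using assms(7) by (simp add: expected_spectral_distribution_def)
  have nonneg: "AE z in \<mu>. 0 \<le> z"
    by (rule expected_spectral_distribution_nonneg[OF assms(7) sym assms(6)])
  have "integrable \<mu> (poly (p\<^sup>2))" for p
    using P orthogonal_polynomials_weight_measure_integrable[OF \<mu> nonneg]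
    unfolding residual_orthogonal_polynomials_def by blast
  then have int: "integrable \<mu> (\<lambda>z. (poly p z)\<^sup>2)" for p
    by (simp add: poly_power[abs_def])
  have r: "(\<lambda>\<omega>. x0 \<omega> - xstar \<omega>) \<in> borel_measurable M"
    using assms(3,4) by simp
  \<comment> \<open>Stated for any \<open>y\<close> whose error comes from one polynomial, so that
    it serves the momentum method and its competitors alike.\<close>
  have error: "(\<integral>\<omega>. (norm (y t \<omega> - xstar \<omega>))\<^sup>2 \<partial>M) = real CARD('n) * R\<^sup>2 * (\<integral>z. (poly p z)\<^sup>2 \<partial>\<mu>)"
    if "\<And>\<omega>. \<omega> \<in> space M \<Longrightarrow> y t \<omega> - xstar \<omega> = matrix_poly p (H \<omega>) *v (x0 \<omega> - xstar \<omega>)" for y :: "nat \<Rightarrow> 'a \<Rightarrow> real ^ 'n" and t p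
  proof -
    have "(\<integral>\<omega>. (norm (y t \<omega> - xstar \<omega>))\<^sup>2 \<partial>M) =
        (\<integral>\<omega>. (norm (matrix_poly p (H \<omega>) *v (x0 \<omega> - xstar \<omega>)))\<^sup>2 \<partial>M)"
      by (intro Bochner_Integration.integral_cong) (simp_all add: that)
    also have "\<dots> = real CARD('n) * R\<^sup>2 * (\<integral>z. (poly p z)\<^sup>2 \<partial>\<mu>)"
      by (rule expectation_norm_matrix_poly[OF assms(1,2) r sym assms(7-9) int])
    finally show ?thesis .
  qed
  have "degree (P 0) = 0" "poly (P 0) 0 = 1"
    using P by (auto simp: residual_orthogonal_polynomials_def orthogonal_polynomials_def)
  then have P0: "P 0 = 1"
    by (auto elim!: degree_eq_zeroE simp: one_pCons)
  have x_error: "(\<integral>\<omega>. (norm (x t \<omega> - xstar \<omega>))\<^sup>2 \<partial>M) = real CARD('n) * R\<^sup>2 * (\<integral>z. (poly (P t) z)\<^sup>2 \<partial>\<mu>)" for t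
    using momentum_iterates_residual[OF sym P0 assms(11)] by (intro error) (simp add: assms(12,13))
  have "(\<integral>\<omega>. (norm (x t \<omega> - xstar \<omega>))\<^sup>2 \<partial>M) \<le> (\<integral>\<omega>. (norm (y t \<omega> - xstar \<omega>))\<^sup>2 \<partial>M)"
    if y: "oblivious_first_order_method M f x0 y" for y t
  proof -
    obtain p where "degree p \<le> t" "poly p 0 = 1"
      and p: "\<And>\<omega>. \<omega> \<in> space M \<Longrightarrow> y t \<omega> - xstar \<omega> = matrix_poly p (H \<omega>) *v (x0 \<omega> - xstar \<omega>)"
      using oblivious_first_order_method_residual[OF sym y[unfolded assms(12)]] by metis
    then have "real CARD('n) * R\<^sup>2 * (\<integral>z. (poly (P t) z)\<^sup>2 \<partial>\<mu>) \<le> real CARD('n) * R\<^sup>2 * (\<integral>z. (poly p z)\<^sup>2 \<partial>\<mu>)"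
      by (intro mult_left_mono residual_orthogonal_polynomials_minimal[OF \<mu> nonneg P]) auto
    also have "\<dots> = (\<integral>\<omega>. (norm (y t \<omega> - xstar \<omega>))\<^sup>2 \<partial>M)"
      by (rule error[symmetric]) (rule p)
    finally show ?thesis
      unfolding x_error .
  qed
  then show ?thesis
    using oblivious_first_order_method_momentum x_error
      residual_orthogonal_polynomials_integral_square[OF \<mu> nonneg P]
    by (simp add: assms(13))
qed

end
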